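(* Let $\mathcal{M}_\Sigma$ be a trace monoid with $\Sigma=\{a_1,\dots,a_n\}$, and write $\Sigma_k=\{a_1,\dots,a_k\}$ ($\Sigma_0=\emptyset$). For integers $0\leqslant k<\ell\leqslant n$ and $p\in(0,p_{\Sigma_k})$, consider the recursive randomized procedure $\mathrm{A}_2(p,k,\ell)$: if $\Sigma_k\cap\mathscr{L}(a_\ell)=\emptyset$, return $\mathbf{e}$. Otherwise set $\xi=\mathbf{e}$; let $\Sigma'_k$ be the connected component of $a_k$ in the graph $(\Sigma_k,\mathcal{R}\cap(\Sigma_k\times\Sigma_k))$; set $r=1-\mu_{\Sigma_k}(p)/\mu_{\Sigma_{k-1}}(p)$ if $\Sigma'_k\cap\mathscr{L}(a_\ell)\neq\emptyset$ and $r=0$ otherwise. Repeat: draw $R\in\{0,1\}$ with $\mathbb{P}(R=1)=r$ and compute $v_\infty=\mathrm{A}_2(p,k-1,\ell)$ (fresh independent randomness each time); until $R=0$, or $a_k\in\mathscr{L}(a_\ell)$, or $v_\infty\notin\mathcal{M}_{\Sigma_{k-1}\setminus\mathscr{L}(a_k)}$. If $R=1$, set $K=1+G$ with $\mathbb{P}(G=j)=(1-r)r^j$ ($j\geqslant0$); else $K=0$. For $i=1,\dots,K$ compute $v_i=\mathrm{A}_2(p,k-1,k)$ independently and set $\xi\gets\xi\cdot v_i\cdot a_k$. Finally set $\xi\gets\xi\cdot v_\infty$ and return $\xi$. Then: the output of $\mathrm{A}_2(p,k,\ell)$ has law $D^{p}_{\Sigma_k,\mathscr{L}(a_\ell)}$.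 Let $L(k,\ell)$ be the length of the output and $S(k,\ell)$ the number of steps of an execution, under the cost model in which all numbers $\mu_X(p)$ are precomputed, each non-recursive line of the procedure (including computing $\Sigma'_k$ and drawing $R$) costs a constant number of steps, and drawing an integer with value $X$ costs at most a constant times $X+1$ steps. Then $L(k,\ell)$ and $S(k,\ell)$ have finite variances, $$\mathbb{E}[S(k,\ell)]=\mathcal{O}\!\left(\frac{\max(k,1)}{\mu_{\Sigma_k}(p)}\right)\quad\text{(with a constant depending only on the cost model)},$$ and $$\mathbb{E}[L(k,\ell)]=p\left(\frac{\mu'_{\Sigma_k\setminus\mathscr{L}(a_\ell)}(p)}{\mu_{\Sigma_k\setminus\mathscr{L}(a_\ell)}(p)}-\frac{\mu'_{\Sigma_k}(p)}{\mu_{\Sigma_k}(p)}\right).$$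
   Context: Let $\Sigma$ be a finite alphabet and $\mathcal{R}$ a reflexive and symmetric binary relation on $\Sigma$. The trace monoid $\mathcal{M}_\Sigma$ is the quotient of $\Sigma^*$ by the congruence generated by $ab=ba$ for all $(a,b)\notin\mathcal{R}$; unit $\mathbf{e}$. For $\Sigma'\subseteq\Sigma$, $\mathcal{M}_{\Sigma'}$ is the submonoid generated by $\Sigma'$. $|x|$ is the length of $x$; $\max(x)$ is the set of letters $a$ with $x=y\cdot a$ for some trace $y$. $\mathscr{L}(a)=\{b\in\Sigma:(a,b)\in\mathcal{R}\}$. For $S\subseteq\Sigma$, a clique of $S$ is a subset of $S$ of pairwise non-$\mathcal{R}$-related letters (empty set included); $\mu_S(X)=\sum_{\gamma\text{ clique of }S}(-1)^{|\gamma|}X^{|\gamma|}$, $\mu_\emptyset=1$, and $\mu'_S$ is its derivative. For $S\neq\emptyset$, $p_S$ is the unique root of smallest modulus of $\mu_S$ (real, $0<p_S\leqslant1$); $p_\emptyset=+\infty$; $p_S\leqslant p_{S'}$ when $S'\subseteq S$. For $p\in(0,p_S)$, $\sum_{x\in\mathcal{M}_S}p^{|x|}=1/\mu_S(p)<\infty$, and $B_{S,p}$ is the probability distribution on $\mathcal{M}_S$ with $B_{S,p}(\{x\})=\mu_S(p)p^{|x|}$. $D^{p}_{S,T}=B_{S,p}(\,\cdot\mid\max(\xi)\subseteq T)$. *)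

theory Defs
  imports "HOL-Analysis.Analysis" "HOL-Probability.Probability"
begin

section \<open>Trace monoids over the alphabet {1..n} (letter a_i is the natural number i)\<close>

definition swap_step :: "(nat \<Rightarrow> nat \<Rightarrow> bool) \<Rightarrow> nat list \<Rightarrow> nat list \<Rightarrow> bool" where
  "swap_step R u v \<longleftrightarrow> (\<exists>x y a b. \<not> R a b \<and> u = x @ [a, b] @ y \<and> v = x @ [b, a] @ y)"

definition teq :: "(nat \<Rightarrow> nat \<Rightarrow> bool) \<Rightarrow> nat list \<Rightarrow> nat list \<Rightarrow> bool" where
  "teq R = (\<lambda>u v. swap_step R u v \<or> swap_step R v u)\<^sup>*\<^sup>*"

definition tr :: "(nat \<Rightarrow> nat \<Rightarrow> bool) \<Rightarrow> nat list \<Rightarrow> nat list set" where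
  "tr R w = {w'. teq R w w'}"

definition submon :: "(nat \<Rightarrow> nat \<Rightarrow> bool) \<Rightarrow> nat set \<Rightarrow> nat list set set" where
  "submon R S = {tr R w | w. set w \<subseteq> S}"

text \<open>Length |x| of a trace (common length of its representatives).\<close>
definition tlen :: "nat list set \<Rightarrow> nat" where
  "tlen x = length (SOME w. w \<in> x)"

definition tmax :: "nat list set \<Rightarrow> nat set" where
  "tmax x = {a. \<exists>v. v @ [a] \<in> x}"

definition Lnb :: "(nat \<Rightarrow> nat \<Rightarrow> bool) \<Rightarrow> nat \<Rightarrow> nat \<Rightarrow> nat set" where
  "Lnb R n a = {b \<in> {1..n}. R a b}"

definition cliques :: "(nat \<Rightarrow> nat \<Rightarrow> bool) \<Rightarrow> nat set \<Rightarrow> nat set set" where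
  "cliques R S = {g. g \<subseteq> S \<and> (\<forall>a\<in>g. \<forall>b\<in>g. a \<noteq> b \<longrightarrow> \<not> R a b)}"

definition mu :: "(nat \<Rightarrow> nat \<Rightarrow> bool) \<Rightarrow> nat set \<Rightarrow> 'a::comm_ring_1 \<Rightarrow> 'a" where
  "mu R S X = (\<Sum>g\<in>cliques R S. (- 1) ^ card g * X ^ card g)"

definition pS :: "(nat \<Rightarrow> nat \<Rightarrow> bool) \<Rightarrow> nat set \<Rightarrow> ereal" where
  "pS R S = (if S = {} then \<infinity> else ereal (Min {cmod z | z::complex. mu R S z = 0}))"

definition Bprob :: "(nat \<Rightarrow> nat \<Rightarrow> bool) \<Rightarrow> nat set \<Rightarrow> real \<Rightarrow> nat list set \<Rightarrow> real" where
  "Bprob R S p x = (if x \<in> submon R S then mu R S p * p ^ tlen x else 0)"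

definition Dprob :: "(nat \<Rightarrow> nat \<Rightarrow> bool) \<Rightarrow> nat set \<Rightarrow> nat set \<Rightarrow> real \<Rightarrow> nat list set \<Rightarrow> real" where
  "Dprob R S T p x =
     (if tmax x \<subseteq> T
      then Bprob R S p x / (\<Sum>\<^sub>\<infinity> y \<in> {y. tmax y \<subseteq> T}. Bprob R S p y)
      else 0)"

definition comp :: "(nat \<Rightarrow> nat \<Rightarrow> bool) \<Rightarrow> nat set \<Rightarrow> nat \<Rightarrow> nat set" where
  "comp R S a = {b \<in> S. (\<lambda>x y. x \<in> S \<and> y \<in> S \<and> R x y)\<^sup>*\<^sup>* a b}"

text \<open>Cost model: every non-recursive line costs c steps; drawing the integer K with
  value X costs dcost X steps. Results are pairs (output word, number of steps);
  the output trace is the class of the output word.\<close>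

text \<open>The repeat loop. sub = the call A_2(p,k-1,l); stop v = the extra until-conditions.
  Returns (R, v_infinity, steps spent in the loop).\<close>
partial_function (spmf) rep_loop ::
  "nat \<Rightarrow> real \<Rightarrow> (nat list \<times> nat) spmf \<Rightarrow> (nat list \<Rightarrow> bool) \<Rightarrow> nat \<Rightarrow> (bool \<times> nat list \<times> nat) spmf"
where
  "rep_loop c r sub stop acc =
     bind_spmf (spmf_of_pmf (bernoulli_pmf r)) (\<lambda>b.
     bind_spmf sub (\<lambda>vs.
       (let acc' = acc + c + (c + snd vs) + c in
        if \<not> b \<or> stop (fst vs) then return_spmf (b, fst vs, acc')
        else rep_loop c r sub stop acc')))"

primrec rep_calls :: "nat \<Rightarrow> nat \<Rightarrow> (nat list \<times> nat) spmf \<Rightarrow> nat \<Rightarrow> (nat list \<times> nat) spmf" where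
  "rep_calls c 0 sub a = return_spmf ([], c)"
| "rep_calls c (Suc m) sub a =
     bind_spmf (rep_calls c m sub a) (\<lambda>ws.
     bind_spmf sub (\<lambda>vs. return_spmf (fst ws @ fst vs @ [a], snd ws + c + snd vs + c)))"

text \<open>A_2(p,k,l), with Sigma_k = {1..k} and L(a) computed in Sigma = {1..n}.
  Step accounting: c for the initial test; if not returning immediately: c each for
  xi := e, computing Sigma'_k, setting r; the loop; c for the if-line choosing K plus
  dcost K for drawing K (or c for setting K = 0); the for loop; c for the final update
  and c for returning.\<close>
primrec A2 :: "nat \<Rightarrow> (nat \<Rightarrow> nat) \<Rightarrow> (nat \<Rightarrow> nat \<Rightarrow> bool) \<Rightarrow> nat \<Rightarrow> real \<Rightarrow> nat \<Rightarrow> nat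
    \<Rightarrow> (nat list \<times> nat) spmf" where
  "A2 c dcost R n p 0 l = return_spmf ([], c + c)"
| "A2 c dcost R n p (Suc k') l =
    (let k = Suc k'; Sk = {1..k}; Sk1 = {1..k'} in
     if Sk \<inter> Lnb R n l = {} then return_spmf ([], c + c)
     else
       (let Sk' = comp R Sk k;
            r = (if Sk' \<inter> Lnb R n l \<noteq> {} then 1 - mu R Sk p / mu R Sk1 p else 0);
            stop = (\<lambda>v. k \<in> Lnb R n l \<or> tr R v \<notin> submon R (Sk1 - Lnb R n k))
        in bind_spmf (rep_loop c r (A2 c dcost R n p k' l) stop 0) (\<lambda>(b, vinf, s1).
           bind_spmf (if b then map_spmf (\<lambda>g. (Suc g, c + dcost (Suc g)))
                                   (spmf_of_pmf (geometric_pmf (1 - r)))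
                      else return_spmf (0, c + c)) (\<lambda>(K, s2).
           bind_spmf (rep_calls c K (A2 c dcost R n p k' k) k) (\<lambda>(xi, s3).
           return_spmf (xi @ vinf, c + c + c + c + s1 + s2 + s3 + c + c))))))"

end

theory Submission
  imports Defs
begin

text \<open>
  Every trace has a unique representative in reversed lexicographic normal form. Cutting such a
  word at the occurrences of its largest letter \<open>k\<close> gives
  \<open>v\<^sub>1 k v\<^sub>2 k \<dots> v\<^sub>m k v\<close>, where the maximal letters of each \<open>v\<^sub>i\<close> are linked to \<open>k\<close>; this is
  exactly the shape the procedure produces. Summing \<open>p ^ length w\<close> over the normal forms \<open>w\<close> over \<open>S\<close>
  whose maximal letters lie in \<open>T\<close> turns the decomposition into a geometric series, and the recursion
  \<open>mu S = mu (S - {k}) - p * mu (S - L(k))\<close> identifies the sum as \<open>mu (S - T) / mu S\<close>. Hence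
  \<open>r = 1 - mu \<Sigma>\<^sub>k / mu \<Sigma>\<^sub>k\<^sub>-\<^sub>1\<close> is \<open>p\<close> times the normalising constant of the \<open>v\<^sub>i\<close>, the output
  probability of \<open>w\<close> is proportional to \<open>p ^ length w\<close>, and losslessness fixes the constant. The length moments
  follow by differentiating the power series.

  For the running time, let \<open>D\<close> bound the mean cost of one round and \<open>M = D / (1 - r)\<close>. A round that
  draws \<open>R = 1\<close> costs a further \<open>M\<close> in expectation whether the loop stops (then \<open>M\<close> pays for the
  \<open>K\<close> calls) or continues, so \<open>D + r * M = M\<close> bounds the total. Since
  \<open>1 / (1 - r) \<le> mu \<Sigma>\<^sub>k\<^sub>-\<^sub>1 / mu \<Sigma>\<^sub>k\<close>, the bounds telescope to \<open>O(k / mu \<Sigma>\<^sub>k)\<close>.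
\<close>

section \<open>Traces and normal forms\<close>

lemma teq_refl [simp]: "teq R u u"
  by (simp add: teq_def)

lemma teq_sym: "teq R u v \<Longrightarrow> teq R v u"
proof -
  have "symp (\<lambda>u v. swap_step R u v \<or> swap_step R v u)" by (auto intro: sympI)
  then show "teq R u v \<Longrightarrow> teq R v u" unfolding teq_def by (meson symp_rtranclp sympE)
qed

lemma teq_trans: "teq R u v \<Longrightarrow> teq R v w \<Longrightarrow> teq R u w"
  unfolding teq_def by (rule rtranclp_trans)

lemma tr_eq_iff: "tr R u = tr R v \<longleftrightarrow> teq R u v"
  unfolding tr_def by (auto intro: teq_sym teq_trans)

lemma teq_induct [consumes 1, case_names swap refl sym trans]:
  assumes "teq R u v"
    and "\<And>x y a b. \<not> R a b \<Longrightarrow> P (x @ [a, b] @ y) (x @ [b, a] @ y)"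
    and "\<And>u. P u u" and "\<And>u v. P u v \<Longrightarrow> P v u" and "\<And>u v w. P u v \<Longrightarrow> P v w \<Longrightarrow> P u w"
  shows "P u v"
  using assms(1) unfolding teq_def
proof (induction rule: rtranclp_induct)
  case (step y z)
  have "P y z" if "swap_step R y z" for y z
    using that assms(2) unfolding swap_step_def by blast
  then have "P y z" using step.hyps assms(4) by blast
  then show ?case using step.IH assms(5) by blast
qed (rule assms(3))

lemma teq_swap: "\<not> R a b \<Longrightarrow> teq R (x @ [a, b] @ y) (x @ [b, a] @ y)"
  unfolding teq_def swap_step_def by blast

lemma teq_append: "teq R u v \<Longrightarrow> teq R (x @ u @ y) (x @ v @ y)"
proof (induction rule: teq_induct)
  case (swap x' y' a b)
  then show ?case using teq_swap[of R a b "x @ x'" "y' @ y"] by simp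
qed (auto intro: teq_sym teq_trans)

lemma teq_mset: "teq R u v \<Longrightarrow> mset u = mset v"
  by (induction rule: teq_induct) auto

lemma teq_set: "teq R u v \<Longrightarrow> set u = set v"
  using teq_mset mset_eq_setD by blast

lemma teq_length: "teq R u v \<Longrightarrow> length u = length v"
  using teq_mset mset_eq_length by blast

lemma teq_rev: "teq R u v \<Longrightarrow> teq R (rev u) (rev v)"
proof (induction rule: teq_induct)
  case (swap x y a b)
  then show ?case using teq_sym[OF teq_swap[of R a b "rev y" "rev x"]] by simp
qed (auto intro: teq_sym teq_trans)

text \<open>Deleting the first \<open>c\<close> either leaves the swapped pair standing or removes
  one of its two letters, and then both words coincide. This is the source of cancellation.\<close>

lemma teq_remove1: "teq R u v \<Longrightarrow> teq R (remove1 c u) (remove1 c v)"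
proof (induction rule: teq_induct)
  case (swap x y a b)
  then show ?case
    using teq_swap[of R a b "remove1 c x" y] teq_swap[of R a b x y] teq_swap[of R a b x "remove1 c y"]
    by (auto simp: remove1_append)
qed (auto intro: teq_sym teq_trans)

text \<open>Reversal brings the last letter to the front, where \<open>remove1\<close> is certain to
  delete that very occurrence in both words.\<close>

lemma teq_snoc_cancel: "teq R (u @ [a]) (v @ [a]) \<Longrightarrow> teq R u v"
  using teq_rev[OF teq_remove1[OF teq_rev, of R "u @ [a]" "v @ [a]" a]] by simp

section \<open>Maximal letters and canonical words\<close>

definition wmax :: "(nat \<Rightarrow> nat \<Rightarrow> bool) \<Rightarrow> nat list \<Rightarrow> nat set" where
  "wmax R w = {a. \<exists>x y. w = x @ [a] @ y \<and> (\<forall>c\<in>set y. \<not> R a c)}"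

text \<open>The reversal of \<open>w\<close> is lexicographically least among the words of its trace.\<close>
definition canon :: "(nat \<Rightarrow> nat \<Rightarrow> bool) \<Rightarrow> nat list \<Rightarrow> bool" where
  "canon R w \<longleftrightarrow> (\<forall>x a u b y. w = x @ [a] @ u @ [b] @ y \<and> a < b \<longrightarrow> (\<exists>c\<in>set (u @ [b]). R a c))"

lemma wmax_Nil [simp]: "wmax R [] = {}"
  by (simp add: wmax_def)

lemma wmaxI: "\<forall>c\<in>set y. \<not> R a c \<Longrightarrow> a \<in> wmax R (x @ a # y)"
  by (auto simp: wmax_def)

lemma wmax_append: "wmax R (u @ v) = wmax R v \<union> {a \<in> wmax R u. \<forall>c\<in>set v. \<not> R a c}"
proof (intro set_eqI iffI)
  fix a assume "a \<in> wmax R (u @ v)"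
  then obtain x y where w: "u @ v = x @ [a] @ y" and y: "\<forall>c\<in>set y. \<not> R a c" by (auto simp: wmax_def)
  from w obtain us where "(u = x @ us \<and> us @ v = [a] @ y) \<or> (u @ us = x \<and> v = us @ [a] @ y)"
    by (auto simp: append_eq_append_conv2)
  then show "a \<in> wmax R v \<union> {a \<in> wmax R u. \<forall>c\<in>set v. \<not> R a c}"
  proof
    assume "u = x @ us \<and> us @ v = [a] @ y"
    then show ?thesis using y wmaxI[of y R a "[]"] by (cases us) (auto intro: wmaxI)
  qed (use y in \<open>auto intro: wmaxI\<close>)
next
  fix a assume "a \<in> wmax R v \<union> {a \<in> wmax R u. \<forall>c\<in>set v. \<not> R a c}"
  then show "a \<in> wmax R (u @ v)"
  proof
    assume "a \<in> wmax R v"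
    then obtain x y where "v = x @ [a] @ y" "\<forall>c\<in>set y. \<not> R a c" by (auto simp: wmax_def)
    then show ?thesis unfolding wmax_def by (intro CollectI exI[of _ "u @ x"] exI[of _ y]) auto
  next
    assume a: "a \<in> {a \<in> wmax R u. \<forall>c\<in>set v. \<not> R a c}"
    then obtain x y where "u = x @ [a] @ y" "\<forall>c\<in>set y. \<not> R a c" by (auto simp: wmax_def)
    then show ?thesis using a unfolding wmax_def by (intro CollectI exI[of _ x] exI[of _ "y @ v"]) auto
  qed
qed

lemma wmax_single [simp]: "wmax R [b] = {b}"
  by (auto simp: wmax_def append_eq_Cons_conv Cons_eq_append_conv)

lemma wmax_snoc: "wmax R (u @ [b]) = insert b {a \<in> wmax R u. \<not> R a b}"
  by (simp add: wmax_append)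

lemma wmax_subset: "wmax R w \<subseteq> set w"
  by (auto simp: wmax_def)

lemma canon_Nil [simp]: "canon R []"
  by (simp add: canon_def)

text \<open>A letter of \<open>w\<close> that is not free to move to its end is already blocked
  inside \<open>w\<close>, so against a new last letter only the maximal letters need to be
  tested.\<close>

lemma canon_snoc: "canon R (w @ [b]) \<longleftrightarrow> canon R w \<and> (\<forall>a\<in>wmax R w. a < b \<longrightarrow> R a b)"
proof (intro iffI conjI ballI impI)
  assume *: "canon R (w @ [b])"
  show "canon R w" unfolding canon_def
  proof (intro allI impI)
    fix x a u b' y assume "w = x @ [a] @ u @ [b'] @ y \<and> a < b'"
    then show "\<exists>c\<in>set (u @ [b']). R a c"
      using *[unfolded canon_def, rule_format, of x a u b' "y @ [b]"] by auto
  qed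
  fix a assume a: "a \<in> wmax R w" "a < b"
  then obtain x y where "w = x @ [a] @ y" "\<forall>c\<in>set y. \<not> R a c" by (auto simp: wmax_def)
  then show "R a b" using *[unfolded canon_def, rule_format, of x a y b "[]"] a by auto
next
  assume *: "canon R w \<and> (\<forall>a\<in>wmax R w. a < b \<longrightarrow> R a b)"
  show "canon R (w @ [b])" unfolding canon_def
  proof (intro allI impI)
    fix x a u b' y assume w: "w @ [b] = x @ [a] @ u @ [b'] @ y \<and> a < b'"
    show "\<exists>c\<in>set (u @ [b']). R a c"
    proof (cases y rule: rev_cases)
      case Nil
      then have "w = x @ [a] @ u" "b = b'" using w by (auto simp flip: append_assoc append_Cons)
      then show ?thesis using * w by (auto simp: wmax_def)
    next
      case (snoc z b'')
      then have "w = x @ [a] @ u @ [b'] @ z" using w by (auto simp flip: append_assoc append_Cons)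
      then show ?thesis using *[THEN conjunct1, unfolded canon_def, rule_format, of x a u b' z] w by auto
    qed
  qed
qed

lemma canon_suffix: "canon R (u @ v) \<Longrightarrow> canon R v"
  unfolding canon_def
proof (intro allI impI)
  fix x a z b y
  assume *: "\<forall>x a z b y. u @ v = x @ [a] @ z @ [b] @ y \<and> a < b \<longrightarrow> (\<exists>c\<in>set (z @ [b]). R a c)"
    and "v = x @ [a] @ z @ [b] @ y \<and> a < b"
  then show "\<exists>c\<in>set (z @ [b]). R a c" using *[rule_format, of "u @ x" a z b y] by simp
qed

text \<open>\<open>R\<close> is a relation on all naturals of which nothing is known outside
  \<open>{1..n}\<close>; this is why the lemmas below confine their words to the alphabet.\<close>

locale dependence =
  fixes R :: "nat \<Rightarrow> nat \<Rightarrow> bool" and n :: nat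
  assumes R_refl: "a \<in> {1..n} \<Longrightarrow> R a a"
    and R_sym: "a \<in> {1..n} \<Longrightarrow> b \<in> {1..n} \<Longrightarrow> R a b \<Longrightarrow> R b a"
begin

lemma wmax_swap:
  assumes "\<not> R a b" "a \<in> {1..n}" "b \<in> {1..n}"
  shows "wmax R (x @ [a, b] @ y) = wmax R (x @ [b, a] @ y)"
proof -
  have "wmax R [a, b] = {a, b}" "wmax R [b, a] = {a, b}"
    using assms R_sym wmax_append[of R "[a]" "[b]"] wmax_append[of R "[b]" "[a]"] by auto
  then show ?thesis by (auto simp del: append_Cons append_Nil simp: wmax_append)
qed

lemma wmax_teq:
  assumes "teq R u v" "set u \<subseteq> {1..n}"
  shows "wmax R u = wmax R v"
proof -
  have "set u = set v \<and> (set u \<subseteq> {1..n} \<longrightarrow> wmax R u = wmax R v)"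
    using assms(1)
  proof (induction rule: teq_induct)
    case (swap x y a b)
    then show ?case using wmax_swap[of a b x y] by (auto simp del: append_Cons)
  qed auto
  then show ?thesis using assms(2) by blast
qed

lemma tmax_tr:
  assumes "set w \<subseteq> {1..n}"
  shows "tmax (tr R w) = wmax R w"
proof (intro set_eqI iffI)
  fix a assume "a \<in> tmax (tr R w)"
  then obtain v where "teq R w (v @ [a])" by (auto simp: tmax_def tr_def)
  then show "a \<in> wmax R w" using wmax_teq[OF _ assms] by (simp add: wmax_snoc)
next
  fix a assume "a \<in> wmax R w"
  then obtain x y where w: "w = x @ [a] @ y" and y: "\<forall>c\<in>set y. \<not> R a c" by (auto simp: wmax_def)
  \<comment> \<open>The free occurrence of \<open>a\<close> is bubbled to the end, past one letter
    of \<open>y\<close> at a time.\<close>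
  have "teq R (x @ [a] @ y) (x @ y @ [a])" using y
  proof (induction y arbitrary: x)
    case (Cons c y)
    have "teq R (x @ [a] @ c # y) (x @ [c] @ [a] @ y)" using teq_swap[of R a c x y] Cons.prems by simp
    moreover have "teq R ((x @ [c]) @ [a] @ y) ((x @ [c]) @ y @ [a])"
      by (rule Cons.IH) (use Cons.prems in auto)
    ultimately show ?case using teq_trans by simp
  qed simp
  then have "(x @ y) @ [a] \<in> tr R w" using w by (simp add: tr_def)
  then show "a \<in> tmax (tr R w)" unfolding tmax_def by blast
qed

lemma tlen_tr: "tlen (tr R w) = length w"
proof -
  have "w \<in> tr R w" by (simp add: tr_def)
  then have "(SOME w'. w' \<in> tr R w) \<in> tr R w" by (rule someI)
  then show ?thesis unfolding tlen_def using teq_length by (fastforce simp: tr_def)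
qed

text \<open>A smaller maximal letter would have to commute with \<open>b\<close>, which canonicity
  forbids. So the last letter is determined by the trace alone, and uniqueness of canonical words
  follows by cancelling it and inducting.\<close>

lemma last_eq_Min_wmax:
  assumes "canon R (w @ [b])"
  shows "b = Min (wmax R (w @ [b]))"
proof -
  have "b \<le> a" if "a \<in> wmax R (w @ [b])" for a
    using that assms by (force simp: canon_snoc wmax_snoc)
  moreover have "finite (wmax R (w @ [b]))" using wmax_subset finite_subset finite_set by metis
  ultimately show ?thesis by (intro Min_eqI[symmetric]) (auto simp: wmax_snoc)
qed

lemma canon_unique:
  assumes "canon R u" "canon R v" "set u \<subseteq> {1..n}" "teq R u v"
  shows "u = v"
  using assms
proof (induction u arbitrary: v rule: rev_induct)
  case Nil
  then show ?case using teq_length by fastforce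
next
  case (snoc b u)
  have sv: "set v \<subseteq> {1..n}" using snoc.prems teq_set by blast
  have "v \<noteq> []" using snoc.prems teq_length by fastforce
  then obtain v' b' where v: "v = v' @ [b']" by (cases v rule: rev_cases) auto
  have "b = b'"
    using last_eq_Min_wmax[of u b] last_eq_Min_wmax[of v' b'] wmax_teq[OF snoc.prems(4,3)] snoc.prems sv v
    by simp
  then show ?case using snoc v teq_snoc_cancel by (auto simp: canon_snoc)
qed

text \<open>Greedy construction from the right: move the least maximal letter to the end, then bring
  the rest into canonical form.\<close>

lemma canon_exists:
  assumes "set w \<subseteq> {1..n}"
  obtains w' where "canon R w'" "teq R w w'"
proof -
  have "\<exists>w'. canon R w' \<and> teq R w w'" using assms
  proof (induction "length w" arbitrary: w)
    case 0
    then show ?case by (intro exI[of _ "[]"]) auto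
  next
    case (Suc m)
    have fin: "finite (wmax R w)" using wmax_subset finite_subset finite_set by metis
    obtain z b0 where "w = z @ [b0]" using Suc.hyps(2) by (cases w rule: rev_cases) auto
    then have ne: "wmax R w \<noteq> {}" by (simp add: wmax_snoc)
    define b where "b = Min (wmax R w)"
    have "b \<in> tmax (tr R w)" using Min_in[OF fin ne] tmax_tr[OF Suc.prems] by (simp add: b_def)
    then obtain v where v: "teq R w (v @ [b])" by (auto simp: tmax_def tr_def)
    have sv: "set (v @ [b]) \<subseteq> {1..n}" using teq_set[OF v] Suc.prems by simp
    obtain v' where v': "canon R v'" "teq R v v'"
      using Suc.hyps(1)[of v] Suc.hyps(2) teq_length[OF v] sv by auto
    have eq: "teq R w (v' @ [b])" using teq_trans[OF v] teq_append[OF v'(2), of "[]" "[b]"] by simp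
    \<comment> \<open>Otherwise \<open>a\<close> would commute with \<open>b\<close>, hence be
      maximal in the whole word and contradict the choice of \<open>b\<close>.\<close>
    have "R a b" if a: "a \<in> wmax R v'" "a < b" for a
    proof (rule ccontr)
      assume "\<not> R a b"
      then have "a \<in> wmax R w" using a wmax_teq[OF eq Suc.prems] by (simp add: wmax_snoc)
      then show False using a(2) Min_le[OF fin] by (force simp: b_def)
    qed
    then show ?case using v' eq by (auto simp: canon_snoc intro!: exI[of _ "v' @ [b]"])
  qed
  then show ?thesis using that by blast
qed

section \<open>Decomposition at the largest letter\<close>

definition CW :: "nat set \<Rightarrow> nat list set" where
  "CW S = {w. set w \<subseteq> S \<and> canon R w}"

text \<open>Unique representatives of the traces on which \<open>Dprob R S T\<close> lives;
  \<open>tr_PW\<close> and \<open>inj_on_tr_PW\<close> make this precise.\<close>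

definition PW :: "nat set \<Rightarrow> nat set \<Rightarrow> nat list set" where
  "PW S T = {w. set w \<subseteq> S \<and> canon R w \<and> wmax R w \<subseteq> T}"

text \<open>When \<open>k\<close> is the largest letter of \<open>S\<close>, these are the words
  that the for loop of the procedure can build in \<open>m\<close> passes.\<close>

primrec blocks :: "nat set \<Rightarrow> nat \<Rightarrow> nat \<Rightarrow> nat list set" where
  "blocks S k 0 = {[]}"
| "blocks S k (Suc m) = (\<lambda>(xi, v). xi @ v @ [k]) ` (blocks S k m \<times> PW (S - {k}) (Lnb R n k))"

lemma canon_append:
  assumes "wmax R xi \<subseteq> {k}" "\<And>a. a \<in> set v \<Longrightarrow> a < k"
  shows "canon R (xi @ v) \<longleftrightarrow> canon R xi \<and> canon R v"
  using assms(2)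
proof (induction v rule: rev_induct)
  case (snoc b v)
  have "canon R (xi @ v @ [b]) \<longleftrightarrow> canon R (xi @ v) \<and> (\<forall>a\<in>wmax R (xi @ v). a < b \<longrightarrow> R a b)"
    using canon_snoc[of R "xi @ v" b] by simp
  also have "(\<forall>a\<in>wmax R (xi @ v). a < b \<longrightarrow> R a b) \<longleftrightarrow> (\<forall>a\<in>wmax R v. a < b \<longrightarrow> R a b)"
    using assms(1) snoc.prems[of b] by (auto simp: wmax_append)
  finally show ?case using snoc by (auto simp: canon_snoc)
qed simp

text \<open>The maximal letters before each closing \<open>k\<close> are \<open>k\<close> itself or
  linked to \<open>k\<close>, so \<open>k\<close> stays the only maximal letter. The last two facts
  let the cut point and \<open>m\<close> be read off a concatenation.\<close>

lemma blocksD: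
  assumes "xi \<in> blocks S k m" "k \<in> S" "S \<subseteq> {1..k}" "k \<le> n"
  shows "set xi \<subseteq> S" "canon R xi" "wmax R xi = (if m = 0 then {} else {k})"
    "xi = [] \<or> last xi = k" "count_list xi k = m"
proof -
  have "set xi \<subseteq> S \<and> canon R xi \<and> wmax R xi = (if m = 0 then {} else {k}) \<and> (xi = [] \<or> last xi = k) \<and> count_list xi k = m"
    using assms(1)
  proof (induction m arbitrary: xi)
    case (Suc m)
    then obtain z v where xi: "xi = z @ v @ [k]" and z: "z \<in> blocks S k m" and v: "v \<in> PW (S - {k}) (Lnb R n k)"
      by auto
    note IH = Suc.IH[OF z]
    have lt: "a < k" if "a \<in> set v" for a using that v assms(3) by (force simp: PW_def)
    have can: "canon R (z @ v)" using canon_append[of z k v] IH v lt by (auto simp: PW_def split: if_splits)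
    have wm: "wmax R (z @ v) \<subseteq> insert k (Lnb R n k)" using IH v by (auto simp: wmax_append PW_def split: if_splits)
    have kn: "k \<in> {1..n}" using assms by auto
    have Rk: "R a k" if "a \<in> wmax R (z @ v)" for a
      using that wm R_refl[OF kn] R_sym[OF kn, of a] by (auto simp: Lnb_def)
    have "canon R xi" using canon_snoc[of R "z @ v" k] can Rk xi by simp
    moreover have "wmax R xi = {k}" using wmax_snoc[of R "z @ v" k] Rk xi by auto
    moreover have "count_list v k = 0" using lt by (auto simp: count_list_0_iff)
    ultimately show ?case using IH v xi assms(2) by (auto simp: PW_def)
  qed simp
  then show "set xi \<subseteq> S" "canon R xi" "wmax R xi = (if m = 0 then {} else {k})"
    "xi = [] \<or> last xi = k" "count_list xi k = m" by auto
qed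

text \<open>Reading from the left, a letter other than \<open>k\<close> extends the current tail,
  and a \<open>k\<close> closes a block. In the second case the maximal letters of the tail are
  smaller than \<open>k\<close>, and canonicity forces them to be linked to it.\<close>

lemma CW_split:
  assumes "w \<in> CW S" "k \<in> S" "S \<subseteq> {1..k}" "k \<le> n"
  shows "\<exists>m xi v. w = xi @ v \<and> xi \<in> blocks S k m \<and> v \<in> CW (S - {k})"
  using assms(1)
proof (induction w rule: rev_induct)
  case Nil
  show ?case by (intro exI[of _ 0] exI[of _ "[]"]) (simp add: CW_def)
next
  case (snoc b u)
  have u: "u \<in> CW S" and b: "b \<in> S" and can: "\<forall>a\<in>wmax R u. a < b \<longrightarrow> R a b"
    using snoc.prems by (auto simp: CW_def canon_snoc)
  obtain m xi v where uv: "u = xi @ v" and xi: "xi \<in> blocks S k m" and v: "v \<in> CW (S - {k})"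
    using snoc.IH[OF u] by blast
  show ?case
  proof (cases "b = k")
    case False
    have "canon R (v @ [b])" using canon_suffix[of R xi "v @ [b]"] snoc.prems uv by (simp add: CW_def)
    then have "v @ [b] \<in> CW (S - {k})" using v b False by (auto simp: CW_def)
    then show ?thesis using uv xi by (intro exI[of _ m] exI[of _ xi] exI[of _ "v @ [b]"]) auto
  next
    case True
    have kn: "k \<in> {1..n}" using assms by auto
    have "a \<in> Lnb R n k" if a: "a \<in> wmax R v" for a
    proof -
      have aS: "a \<in> S - {k}" using a v wmax_subset[of R v] by (auto simp: CW_def)
      then have "a < k" "a \<in> {1..n}" using assms(3,4) by force+
      moreover have "a \<in> wmax R u" using a uv by (simp add: wmax_append)
      ultimately show ?thesis using can True R_sym[of a k] kn by (auto simp: Lnb_def)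
    qed
    then have "v \<in> PW (S - {k}) (Lnb R n k)" using v by (auto simp: CW_def PW_def)
    then have "u @ [b] \<in> blocks S k (Suc m)" using uv xi True by force
    then show ?thesis by (intro exI[of _ "Suc m"] exI[of _ "u @ [b]"] exI[of _ "[]"]) (simp add: CW_def)
  qed
qed

text \<open>If blocks precede the tail, the final \<open>k\<close> becomes maximal unless some
  letter of the tail blocks it. The condition keeps the maximal letters within \<open>T\<close>, and
  it is the one under which the repeat loop may stop with \<open>R = 1\<close>.\<close>

definition tails :: "nat set \<Rightarrow> nat set \<Rightarrow> nat \<Rightarrow> nat \<Rightarrow> nat list set" where
  "tails S T k m = {v \<in> PW (S - {k}) T. m = 0 \<or> k \<in> T \<or> (\<exists>c\<in>set v. R k c)}"

lemma PW_decomp: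
  assumes "k \<in> S" "S \<subseteq> {1..k}" "k \<le> n"
  shows "PW S T = (\<lambda>(m, xi, v). xi @ v) ` (SIGMA m:UNIV. blocks S k m \<times> tails S T k m)"
proof (intro set_eqI iffI)
  fix w assume w: "w \<in> PW S T"
  then have "w \<in> CW S" by (auto simp: PW_def CW_def)
  then obtain m xi v where wv: "w = xi @ v" and xi: "xi \<in> blocks S k m" and v: "v \<in> CW (S - {k})"
    using CW_split assms by blast
  have "v \<in> tails S T k m"
    using w v blocksD[OF xi assms] unfolding wv by (auto simp: tails_def PW_def CW_def wmax_append)
  then show "w \<in> (\<lambda>(m, xi, v). xi @ v) ` (SIGMA m:UNIV. blocks S k m \<times> tails S T k m)"
    using wv xi by force
next
  fix w assume "w \<in> (\<lambda>(m, xi, v). xi @ v) ` (SIGMA m:UNIV. blocks S k m \<times> tails S T k m)"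
  then obtain m xi v where wv: "w = xi @ v" and xi: "xi \<in> blocks S k m" and v: "v \<in> tails S T k m"
    by auto
  have "a < k" if "a \<in> set v" for a using that v assms(2) by (force simp: tails_def PW_def)
  then have "canon R w" using canon_append[of xi k v] blocksD[OF xi assms] v wv
    by (auto simp: tails_def PW_def split: if_splits)
  then show "w \<in> PW S T" using v blocksD[OF xi assms] unfolding wv
    by (auto simp: tails_def PW_def wmax_append split: if_splits)
qed

text \<open>Both cuts lie immediately after the last occurrence of \<open>k\<close>, or at the start
  of the word if there is none.\<close>

lemma append_block_inject:
  assumes "xi @ v = xi' @ v'" "k \<notin> set v" "k \<notin> set v'" "xi = [] \<or> last xi = k" "xi' = [] \<or> last xi' = k"
  shows "xi = xi' \<and> v = v'"
proof -
  have *: "us = []" if "ys = xs @ us" "k \<notin> set us" "ys = [] \<or> last ys = k" for xs ys us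
    using that by (cases us rule: rev_cases) auto
  from assms(1) obtain us where "(xi = xi' @ us \<and> us @ v = v') \<or> (xi @ us = xi' \<and> v = us @ v')"
    by (auto simp: append_eq_append_conv2)
  then show ?thesis
  proof
    assume A: "xi = xi' @ us \<and> us @ v = v'"
    have "us = []" by (rule *[of xi xi']) (use A assms(3,4) in auto)
    then show ?thesis using A by simp
  next
    assume A: "xi @ us = xi' \<and> v = us @ v'"
    have "us = []" by (rule *[of xi' xi]) (use A assms(2,5) in auto)
    then show ?thesis using A by simp
  qed
qed

lemma inj_on_decomp:
  assumes "k \<in> S" "S \<subseteq> {1..k}" "k \<le> n"
  shows "inj_on (\<lambda>(m, xi, v). xi @ v) (SIGMA m:UNIV. blocks S k m \<times> tails S T k m)"
proof (rule inj_onI, clarsimp simp del: append_eq_append_conv)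
  fix m xi v m' xi' v'
  assume eq: "xi @ v = xi' @ v'" and xi: "xi \<in> blocks S k m" "xi' \<in> blocks S k m'"
    and v: "v \<in> tails S T k m" "v' \<in> tails S T k m'"
  have "xi = xi' \<and> v = v'"
    using append_block_inject[OF eq, of k] v blocksD(4)[OF xi(1) assms] blocksD(4)[OF xi(2) assms]
    by (auto simp: tails_def PW_def)
  moreover from this have "m = m'"
    using blocksD(5)[OF xi(1) assms] blocksD(5)[OF xi(2) assms] by auto
  ultimately show "m = m' \<and> xi = xi' \<and> v = v'" by simp
qed

lemma inj_on_blocks:
  assumes "k \<in> S" "S \<subseteq> {1..k}" "k \<le> n"
  shows "inj_on (\<lambda>(xi, v). xi @ v @ [k]) (blocks S k m \<times> PW (S - {k}) T)"
proof (intro inj_onI, clarify)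
  fix xi v xi' v'
  assume eq: "xi @ v @ [k] = xi' @ v' @ [k]" and xi: "xi \<in> blocks S k m" "xi' \<in> blocks S k m"
    and v: "v \<in> PW (S - {k}) T" "v' \<in> PW (S - {k}) T"
  have "xi @ v = xi' @ v'" using eq by (simp flip: append_assoc)
  from append_block_inject[OF this, of k] v blocksD(4)[OF xi(1) assms] blocksD(4)[OF xi(2) assms]
  show "xi = xi' \<and> v = v'" by (auto simp: PW_def)
qed

text \<open>If \<open>k\<close> occurs, take the last letter of the word that lies in the component
  of \<open>k\<close>. Nothing after it is linked to it, so it is maximal, yet outside
  \<open>T\<close>. This justifies the choice \<open>r = 0\<close> in the procedure.\<close>

lemma PW_component:
  assumes "comp R S k \<inter> T = {}"
  shows "PW S T = PW (S - {k}) T"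
proof -
  have False if w: "w \<in> PW S T" and k: "k \<in> set w" for w
  proof -
    have "k \<in> comp R S k" using w k by (auto simp: comp_def PW_def)
    then have "\<exists>a\<in>set w. a \<in> comp R S k" using k by blast
    from split_list_last_prop[OF this]
    obtain x a y where wa: "w = x @ a # y" and a: "a \<in> comp R S k" and y: "\<forall>c\<in>set y. c \<notin> comp R S k"
      by blast
    have "\<not> R a c" if c: "c \<in> set y" for c
    proof
      assume "R a c"
      moreover have "c \<in> S" using w wa c by (auto simp: PW_def)
      ultimately have "c \<in> comp R S k" using a by (auto simp: comp_def intro: rtranclp.rtrancl_into_rtrancl)
      then show False using y c by blast
    qed
    then have "a \<in> wmax R w" using wa by (auto intro: wmaxI)
    then show False using w a assms by (auto simp: PW_def)
  qed
  then show ?thesis by (auto simp: PW_def)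
qed

lemma PW_disjoint: "S \<inter> T = {} \<Longrightarrow> PW S T = {[]}"
proof -
  assume "S \<inter> T = {}"
  then have "w = []" if "w \<in> PW S T" for w
    using that by (cases w rule: rev_cases) (auto simp: PW_def wmax_snoc)
  moreover have "[] \<in> PW S T" by (simp add: PW_def)
  ultimately show ?thesis by blast
qed

lemma inj_on_tr_PW: "S \<subseteq> {1..n} \<Longrightarrow> inj_on (tr R) (PW S T)"
  by (rule inj_onI, rule canon_unique) (auto simp: PW_def tr_eq_iff)

text \<open>Together with injectivity this turns sums over conditioned traces into sums over
  words.\<close>

lemma tr_PW:
  assumes "S \<subseteq> {1..n}"
  shows "tr R ` PW S T = {x \<in> submon R S. tmax x \<subseteq> T}"
proof (intro set_eqI iffI)
  fix x assume "x \<in> tr R ` PW S T"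
  then show "x \<in> {x \<in> submon R S. tmax x \<subseteq> T}" using assms tmax_tr by (force simp: PW_def submon_def)
next
  fix x assume "x \<in> {x \<in> submon R S. tmax x \<subseteq> T}"
  then obtain w where x: "x = tr R w" "set w \<subseteq> S" "tmax x \<subseteq> T" by (auto simp: submon_def)
  obtain w' where w': "canon R w'" "teq R w w'" using canon_exists[of w] x(2) assms by blast
  have s: "set w' \<subseteq> S" using teq_set w'(2) x(2) by blast
  have "x = tr R w'" using x(1) w'(2) tr_eq_iff by blast
  moreover have "w' \<in> PW S T" using w' s x(3) tmax_tr[of w'] assms calculation by (auto simp: PW_def)
  ultimately show "x \<in> tr R ` PW S T" by blast
qed

lemma tr_in_submon_iff: "tr R v \<in> submon R S \<longleftrightarrow> set v \<subseteq> S"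
  using teq_set teq_refl unfolding submon_def tr_eq_iff mem_Collect_eq by blast

end

section \<open>Moebius polynomials\<close>

context dependence begin

lemma finite_cliques: "finite S \<Longrightarrow> finite (cliques R S)"
  by (rule finite_subset[of _ "Pow S"]) (auto simp: cliques_def)

lemma mu_empty [simp]: "mu R {} x = 1"
proof -
  have "cliques R {} = {{}}" by (auto simp: cliques_def)
  then show ?thesis by (simp add: mu_def)
qed

text \<open>Cliques avoiding \<open>a\<close> give the first term. Those containing \<open>a\<close>
  arise by adding \<open>a\<close> to a clique of letters not linked to \<open>a\<close>, which
  contributes one factor \<open>- x\<close>.\<close>

lemma mu_rec:
  fixes x :: "'a::comm_ring_1"
  assumes "a \<in> S" "S \<subseteq> {1..n}"
  shows "mu R S x = mu R (S - {a}) x - x * mu R (S - Lnb R n a) x"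
proof -
  have fin: "finite S" using assms(2) finite_subset by blast
  have a: "a \<in> {1..n}" using assms by auto
  let ?C = "{g \<in> cliques R S. a \<in> g}"
  have split: "cliques R S = cliques R (S - {a}) \<union> ?C" by (auto simp: cliques_def)
  have disj: "cliques R (S - {a}) \<inter> ?C = {}" by (auto simp: cliques_def)
  have C: "?C = insert a ` cliques R (S - Lnb R n a)"
  proof (intro set_eqI iffI)
    fix g assume g: "g \<in> ?C"
    have "g - {a} \<in> cliques R (S - Lnb R n a)" using g by (auto simp: cliques_def Lnb_def)
    moreover have "g = insert a (g - {a})" using g by auto
    ultimately show "g \<in> insert a ` cliques R (S - Lnb R n a)" by blast
  next
    fix g assume "g \<in> insert a ` cliques R (S - Lnb R n a)"
    then obtain h where h: "g = insert a h" "h \<in> cliques R (S - Lnb R n a)" by auto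
    have "\<not> R a b \<and> \<not> R b a" if "b \<in> h" for b
    proof -
      have "b \<in> S" "b \<notin> Lnb R n a" using that h by (auto simp: cliques_def)
      then show ?thesis using assms(2) R_sym[of b a] a by (auto simp: Lnb_def)
    qed
    then show "g \<in> ?C" using h assms(1) by (auto simp: cliques_def)
  qed
  have na: "a \<notin> h" "finite h" if "h \<in> cliques R (S - Lnb R n a)" for h
    using that a R_refl[OF a] fin finite_subset[of h S] by (auto simp: cliques_def Lnb_def)
  have "mu R S x = mu R (S - {a}) x + (\<Sum>g\<in>?C. (- 1) ^ card g * x ^ card g)"
    unfolding mu_def by (subst split, subst sum.union_disjoint) (use fin finite_cliques disj in auto)
  also have "(\<Sum>g\<in>?C. (- 1) ^ card g * x ^ card g)
      = (\<Sum>h\<in>cliques R (S - Lnb R n a). (- 1) ^ card (insert a h) * x ^ card (insert a h))"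
    unfolding C by (subst sum.reindex) (auto simp: inj_on_def dest: na(1) intro!: insert_ident[THEN iffD1])
  also have "\<dots> = - (x * mu R (S - Lnb R n a) x)"
    unfolding mu_def sum_distrib_left sum_negf[symmetric]
    by (intro sum.cong) (auto simp: na algebra_simps)
  finally show ?thesis by simp
qed

section \<open>Behaviour on the real line and positivity below the smallest root\<close>

lemma mu_of_real: "mu R S (of_real x :: complex) = of_real (mu R S x)"
  by (simp add: mu_def)

lemma continuous_on_mu [continuous_intros]: "continuous_on A (mu R S :: real \<Rightarrow> real)"
  unfolding mu_def by (intro continuous_intros)

lemma mu_differentiable: "(mu R S :: real \<Rightarrow> real) field_differentiable at x"
  unfolding mu_def by (intro field_differentiable_sum field_differentiable_mult
      field_differentiable_const field_differentiable_power field_differentiable_ident)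

lemma mu_0: "finite S \<Longrightarrow> mu R S 0 = (1 :: 'a :: comm_ring_1)"
proof -
  assume fin: "finite S"
  have fin': "finite g" if "g \<in> cliques R S" for g
    using that finite_subset[OF _ fin] by (auto simp: cliques_def)
  have "mu R S (0::'a) = (\<Sum>g\<in>cliques R S. if g = {} then 1 else 0)"
    unfolding mu_def using fin' by (intro sum.cong) (auto simp: power_0_left)
  also have "\<dots> = 1" using finite_cliques[OF fin] by (subst sum.delta) (auto simp: cliques_def)
  finally show ?thesis .
qed

text \<open>Positivity on the whole interval replaces the condition that \<open>p\<close> is below
  the smallest root: it passes to smaller alphabets by a purely real argument.\<close>

definition mu_pos :: "nat set \<Rightarrow> real \<Rightarrow> bool" where
  "mu_pos S p \<longleftrightarrow> (\<forall>t\<in>{0..p}. 0 < mu R S t)"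

text \<open>At the first zero of \<open>mu (S - {a})\<close> the recursion would force \<open>mu S \<le> 0\<close>.\<close>
lemma mu_pos_remove:
  assumes "S \<subseteq> {1..n}" "mu_pos S p" "a \<in> S"
    and IH: "\<And>q. mu_pos (S - {a}) q \<Longrightarrow> mu_pos (S - Lnb R n a) q"
  shows "mu_pos (S - {a}) p"
proof (rule ccontr)
  let ?f = "mu R (S - {a}) :: real \<Rightarrow> real"
  have fin: "finite (S - {a})" using assms(1) finite_subset[of S] by auto
  assume "\<not> mu_pos (S - {a}) p"
  then obtain t0 where t0: "t0 \<in> {0..p}" "?f t0 \<le> 0" by (auto simp: mu_pos_def not_less)
  define Z where "Z = {t \<in> {0..t0}. ?f t = 0}"
  have "\<exists>t\<ge>0. t \<le> t0 \<and> ?f t = 0"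
    by (rule IVT2') (use t0 mu_0[OF fin] in \<open>auto intro: continuous_intros\<close>)
  then have ne: "Z \<noteq> {}" by (auto simp: Z_def)
  have "closed Z"
  proof -
    have "Z = {0..t0} \<inter> ?f -` {0}" by (auto simp: Z_def)
    then show ?thesis using continuous_closed_preimage[OF continuous_on_mu, of "{0..t0}" "{0}"] by simp
  qed
  \<comment> \<open>Compactness provides the first zero \<open>t\<close>.\<close>
  then have "compact Z" using compact_Int_closed[OF compact_Icc[of 0 t0], of Z] by (simp add: Z_def Int_def conj_ac)
  then obtain t where t: "t \<in> Z" "\<And>s. s \<in> Z \<Longrightarrow> t \<le> s" using compact_attains_inf[OF _ ne] by blast
  have tp: "0 \<le> t" "t \<le> p" "?f t = 0" using t t0 by (auto simp: Z_def)
  have pos: "0 < ?f s" if s: "0 \<le> s" "s < t" for s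
  proof (rule ccontr)
    assume "\<not> 0 < ?f s"
    then have "\<exists>u\<ge>0. u \<le> s \<and> ?f u = 0"
      by (intro IVT2') (use s mu_0[OF fin] in \<open>auto intro: continuous_intros\<close>)
    then obtain u where "0 \<le> u" "u \<le> s" "?f u = 0" by auto
    then show False using t(2)[of u] s t(1) by (force simp: Z_def)
  qed
  have pos': "0 < mu R (S - Lnb R n a) s" if s: "0 \<le> s" "s < t" for s :: real
  proof -
    have "mu_pos (S - {a}) s" using pos s by (auto simp: mu_pos_def)
    from IH[OF this] show ?thesis using s by (auto simp: mu_pos_def)
  qed
  have "t \<noteq> 0" using tp mu_0[OF fin, where 'a = real] by auto
  \<comment> \<open>The induction hypothesis applies only strictly before \<open>t\<close>; the left
    limit keeps the weak inequality, which is enough.\<close>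
  have "0 \<le> mu R (S - Lnb R n a) t"
  proof (rule tendsto_lowerbound)
    show "((mu R (S - Lnb R n a) :: real \<Rightarrow> real) \<longlongrightarrow> mu R (S - Lnb R n a) t) (at_left t)"
      using continuous_on_mu[of UNIV "S - Lnb R n a"]
      by (simp add: continuous_on_eq_continuous_at isCont_def filterlim_at_split)
    show "\<forall>\<^sub>F s in at_left t. 0 \<le> mu R (S - Lnb R n a) s"
      using eventually_at_left_real[of 0 t] \<open>t \<noteq> 0\<close> tp
      by (auto elim!: eventually_mono intro: less_imp_le pos')
  qed simp
  then have "mu R S t \<le> 0" using mu_rec[OF assms(3,1), of t] tp by simp
  then show False using assms(2) tp by (force simp: mu_pos_def)
qed

text \<open>Letters are removed one at a time. As \<open>a\<close> is linked to itself,
  \<open>S - Lnb R n a\<close> is contained in \<open>S - {a}\<close>, so strong induction supplies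
  the hypothesis of \<open>mu_pos_remove\<close>.\<close>

lemma mu_pos_subset:
  assumes "S \<subseteq> {1..n}" "mu_pos S p" "T \<subseteq> S"
  shows "mu_pos T p"
proof -
  have "finite S" using assms(1) finite_subset by blast
  then show ?thesis using assms
  proof (induction S arbitrary: T p rule: finite_psubset_induct)
    case (psubset S)
    show ?case
    proof (cases "T = S")
      case False
      then obtain a where a: "a \<in> S" "a \<notin> T" using psubset.prems by blast
      have "mu_pos (S - {a}) p"
      proof (rule mu_pos_remove)
        fix q assume "mu_pos (S - {a}) q"
        moreover have "S - Lnb R n a \<subseteq> S - {a}" using a psubset.prems(1) R_refl by (auto simp: Lnb_def)
        ultimately show "mu_pos (S - Lnb R n a) q"
          using psubset.IH[of "S - {a}"] a psubset.prems(1) by blast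
      qed (use psubset a in auto)
      then show ?thesis using psubset.IH[of "S - {a}" p T] a psubset.prems by blast
    qed (use psubset in simp)
  qed
qed

lemma mu_posD: "mu_pos S p \<Longrightarrow> 0 \<le> p \<Longrightarrow> 0 < mu R S p"
  by (auto simp: mu_pos_def)

lemma mu_pos_mono: "mu_pos S p \<Longrightarrow> q \<le> p \<Longrightarrow> mu_pos S q"
  by (auto simp: mu_pos_def)

text \<open>The coefficient of degree one is minus the number of singleton cliques, so the
  polynomial is not zero. Finiteness makes \<open>Min\<close> in \<open>pS\<close> a genuine minimum
  bound.\<close>

lemma finite_mu_roots:
  assumes "S \<subseteq> {1..n}" "S \<noteq> {}"
  shows "finite {z :: complex. mu R S z = 0}"
proof -
  have fin: "finite S" using assms(1) finite_subset by blast
  define P :: "complex poly" where "P = (\<Sum>g\<in>cliques R S. monom ((- 1) ^ card g) (card g))"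
  have P: "poly P z = mu R S z" for z by (simp add: P_def mu_def poly_sum poly_monom)
  obtain a where a: "a \<in> S" using assms(2) by blast
  have fin': "finite g" if "g \<in> cliques R S" for g
    using that finite_subset[OF _ fin] by (auto simp: cliques_def)
  have "coeff P 1 = (\<Sum>g\<in>cliques R S. if card g = 1 then - 1 else 0)"
    unfolding P_def coeff_sum by (intro sum.cong) auto
  also have "\<dots> = - of_nat (card {g \<in> cliques R S. card g = 1})"
    using finite_cliques[OF fin] by (simp add: sum.If_cases Int_def)
  finally have c: "coeff P 1 = - of_nat (card {g \<in> cliques R S. card g = 1})" .
  have "{a} \<in> {g \<in> cliques R S. card g = 1}" using a by (auto simp: cliques_def)
  then have "card {g \<in> cliques R S. card g = 1} \<noteq> 0" using finite_cliques[OF fin] by auto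
  then have "coeff P 1 \<noteq> 0" using c by simp
  then have "P \<noteq> 0" by auto
  then show "finite {z :: complex. mu R S z = 0}" using poly_roots_finite[of P] by (simp add: P)
qed

text \<open>\<open>mu\<close> is 1 at 0 and has no real zero up to \<open>p'\<close>, so it cannot
  change sign. The room between \<open>p\<close> and \<open>p'\<close> is used later to
  differentiate power series at \<open>p\<close>.\<close>

lemma mu_pos_of_less_pS:
  assumes "S \<subseteq> {1..n}" "ereal p < pS R S"
  shows "\<exists>p'>p. mu_pos S p'"
proof (cases "S = {}")
  case True
  then show ?thesis by (intro exI[of _ "p + 1"]) (simp add: mu_pos_def)
next
  case False
  have fin: "finite S" using assms(1) finite_subset by blast
  let ?Z = "{cmod z | z::complex. mu R S z = 0}"
  have "?Z = cmod ` {z. mu R S z = 0}" by auto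
  then have finZ: "finite ?Z" using finite_mu_roots[OF assms(1) False] by simp
  have "p < Min ?Z" using assms(2) False by (simp add: pS_def)
  then obtain p' where p': "p < p'" "p' < Min ?Z" using dense by blast
  have nz: "mu R S t \<noteq> 0" if t: "t \<in> {0..p'}" for t :: real
  proof
    assume "mu R S t = 0"
    then have "mu R S (of_real t :: complex) = 0" by (simp add: mu_of_real)
    then have "cmod (of_real t) \<in> ?Z" by blast
    from Min_le[OF finZ this] show False using t p' by simp
  qed
  have "mu_pos S p'" unfolding mu_pos_def
  proof (intro ballI, rule ccontr)
    fix t assume t: "t \<in> {0..p'}" "\<not> 0 < mu R S t"
    then have "\<exists>s\<ge>0. s \<le> t \<and> mu R S s = 0"
      by (intro IVT2') (use t fin mu_0[OF fin] in \<open>auto intro: continuous_intros\<close>)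
    then show False using nz t by auto
  qed
  then show ?thesis using p' by blast
qed

end

section \<open>Generating functions\<close>

lemma has_sum_product_nonneg:
  fixes f :: "'a \<Rightarrow> real" and g :: "'b \<Rightarrow> real"
  assumes f: "(f has_sum a) A" and g: "(g has_sum b) B"
    and nonneg: "\<And>x. x \<in> A \<Longrightarrow> 0 \<le> f x" "\<And>y. y \<in> B \<Longrightarrow> 0 \<le> g y"
  shows "((\<lambda>(x, y). f x * g y) has_sum a * b) (A \<times> B)"
proof (rule has_sum_SigmaI)
  show "((\<lambda>y. (case (x, y) of (x, y) \<Rightarrow> f x * g y)) has_sum f x * b) B" for x
    using has_sum_cmult_right[OF g, of "f x"] by simp
  show 1: "((\<lambda>x. f x * b) has_sum a * b) A" by (rule has_sum_cmult_left[OF f])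
  show "(\<lambda>(x, y). f x * g y) summable_on A \<times> B"
    by (rule summable_on_SigmaI[where g = "\<lambda>x. f x * b"])
      (use has_sum_cmult_right[OF g] 1 nonneg in \<open>auto simp: summable_on_def\<close>)
qed

context dependence begin

text \<open>Each block contributes \<open>Z\<close> for its word and a factor \<open>p\<close> for
  its closing \<open>k\<close>.\<close>

lemma blocks_has_sum:
  fixes p :: real
  assumes "k \<in> S" "S \<subseteq> {1..k}" "k \<le> n" "0 \<le> p"
    and Z: "((\<lambda>w. p ^ length w) has_sum Z) (PW (S - {k}) (Lnb R n k))"
  shows "((\<lambda>w. p ^ length w) has_sum (p * Z) ^ m) (blocks S k m)"
proof (induction m)
  case 0
  show ?case using has_sum_finite[of "{[]}" "\<lambda>w. p ^ length w"] by simp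
next
  case (Suc m)
  have "((\<lambda>(xi, v). p ^ length xi * p ^ length v) has_sum (p * Z) ^ m * Z)
      (blocks S k m \<times> PW (S - {k}) (Lnb R n k))"
    by (rule has_sum_product_nonneg[OF Suc Z]) (use assms in auto)
  from has_sum_cmult_right[OF this, of p] show ?case
    unfolding blocks.simps
    by (subst has_sum_reindex[OF inj_on_blocks[OF assms(1-3)]])
       (simp add: o_def split_def power_add mult_ac)
qed

lemma PW_avoid:
  assumes "k \<in> {1..n}" "S \<subseteq> {1..n}"
  shows "{v \<in> PW (S - {k}) T. \<forall>c\<in>set v. \<not> R k c} = PW (S - Lnb R n k) T"
  using R_refl[OF assms(1)] assms by (auto simp: PW_def Lnb_def subset_eq)

text \<open>For \<open>m > 0\<close> and \<open>k\<close> outside \<open>T\<close>, the words to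
  discard are those without a letter linked to \<open>k\<close>, that is, the words over
  \<open>S - Lnb R n k\<close>.\<close>

lemma tails_has_sum:
  fixes p :: real
  assumes "k \<in> {1..n}" "S \<subseteq> {1..n}"
    and Z1: "((\<lambda>w. p ^ length w) has_sum Z1) (PW (S - {k}) T)"
    and Z2: "((\<lambda>w. p ^ length w) has_sum Z2) (PW (S - Lnb R n k) T)"
  shows "((\<lambda>w. p ^ length w) has_sum (if m = 0 \<or> k \<in> T then Z1 else Z1 - Z2)) (tails S T k m)"
proof (cases "m = 0 \<or> k \<in> T")
  case True
  then have "tails S T k m = PW (S - {k}) T" by (auto simp: tails_def)
  then show ?thesis using Z1 True by simp
next
  case False
  have "tails S T k m = PW (S - {k}) T - PW (S - Lnb R n k) T"
    using False PW_avoid[OF assms(1,2), of T, symmetric] by (auto simp: tails_def)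
  moreover have "PW (S - Lnb R n k) T \<subseteq> PW (S - {k}) T"
    using PW_avoid[OF assms(1,2), of T, symmetric] by auto
  ultimately show ?thesis using has_sum_Diff[OF Z1 Z2] False by simp
qed

text \<open>Cutting canonical words at the largest letter turns the recursion of \<open>mu\<close> into a
  geometric series.\<close>
lemma PW_has_sum:
  fixes p :: real
  assumes "S \<subseteq> {1..n}" "mu_pos S p" "0 \<le> p"
  shows "((\<lambda>w. p ^ length w) has_sum mu R (S - T) p / mu R S p) (PW S T)"
proof -
  have "((\<lambda>w. p ^ length w) has_sum mu R (S - T) p / mu R S p) (PW S T)"
    if "k \<le> n" "S \<subseteq> {1..k}" "mu_pos S p" for k S T
    using that
  \<comment> \<open>The induction is on a bound for the letters, so that \<open>S - {k}\<close> and
    \<open>S - Lnb R n k\<close> are both covered by the hypothesis.\<close>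
  proof (induction k arbitrary: S T)
    case 0
    then have "S = {}" by auto
    then show ?case using has_sum_finite[of "{[]}" "\<lambda>w. p ^ length w"] by (simp add: PW_disjoint)
  next
    case (Suc k')
    show ?case
    proof (cases "Suc k' \<in> S")
      case False
      have "x \<le> k'" if "x \<in> S" for x using that False Suc.prems(2) by (cases "x = Suc k'") force+
      then have "S \<subseteq> {1..k'}" using Suc.prems(2) by auto
      then show ?thesis using Suc by simp
    next
      case True
      define k where "k = Suc k'"
      have k: "k \<in> S" "S \<subseteq> {1..k}" "k \<le> n" "k \<in> {1..n}" "S \<subseteq> {1..n}"
        using True Suc.prems by (auto simp: k_def)
      let ?S1 = "S - {k}" and ?S2 = "S - Lnb R n k"
      have kL: "k \<in> Lnb R n k" using R_refl k by (simp add: Lnb_def)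
      have "{1..k} - {k} = {1..k'}" by (auto simp: k_def)
      then have S1: "?S1 \<subseteq> {1..k'}" using k(2) by blast
      then have S2: "?S2 \<subseteq> {1..k'}" using kL by auto
      have pos: "mu_pos ?S1 p" "mu_pos ?S2 p" using mu_pos_subset[OF k(5) Suc.prems(3)] by auto
      define M M1 M2 where "M = mu R S p" and "M1 = mu R ?S1 p" and "M2 = mu R ?S2 p"
      have Mpos: "0 < M" "0 < M1" "0 < M2"
        using pos Suc.prems(3) mu_posD assms(3) by (auto simp: M_def M1_def M2_def)
      define Z1 where "Z1 = mu R (?S1 - T) p / M1"
      define Z2 where "Z2 = mu R (?S2 - T) p / M2"
      define r where "r = p * (M2 / M1)"
      have "?S1 - Lnb R n k = ?S2" using kL by auto
      then have "((\<lambda>w. p ^ length w) has_sum M2 / M1) (PW ?S1 (Lnb R n k))"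
        using Suc.IH[OF _ S1 pos(1), of "Lnb R n k"] k(3) by (simp add: M1_def M2_def k_def)
      from blocks_has_sum[OF k(1-3) assms(3) this]
      have bl: "((\<lambda>w. p ^ length w) has_sum r ^ m) (blocks S k m)" for m by (simp add: r_def)
      define t where "t m = (if m = 0 \<or> k \<in> T then Z1 else Z1 - Z2)" for m :: nat
      have tl: "((\<lambda>w. p ^ length w) has_sum t m) (tails S T k m)" for m
        unfolding t_def
        by (rule tails_has_sum[OF k(4,5)])
          (use Suc.IH[OF _ S1 pos(1), of T] Suc.IH[OF _ S2 pos(2), of T] k(3) in
            \<open>auto simp: k_def Z1_def Z2_def M1_def M2_def\<close>)
      \<comment> \<open>The recursion identifies the ratio of the geometric series:
        \<open>1 - r\<close> is \<open>M / M1\<close>, and positivity of both gives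
        \<open>r < 1\<close>.\<close>
      have "M = M1 - p * M2" unfolding M_def M1_def M2_def by (rule mu_rec[OF k(1,5)])
      then have r1: "1 - r = M / M1" using Mpos by (simp add: r_def field_simps)
      have r: "0 \<le> r" "r < 1"
        using assms(3) Mpos r1 divide_pos_pos[OF Mpos(1,2)] by (simp add: r_def, linarith)
      define G where "G = (if k \<in> T then Z1 else Z1 - r * Z2) / (1 - r)"
      \<comment> \<open>For \<open>k\<close> outside \<open>T\<close> the factor after
        \<open>r ^ m\<close> is constantly \<open>Z1 - Z2\<close>, except at \<open>m = 0\<close>,
        where \<open>Z2\<close> has to be added back.\<close>
      have "(\<lambda>m. r ^ m * (Z1 - Z2)) sums (1 / (1 - r) * (Z1 - Z2))"
        by (intro sums_mult2 geometric_sums) (use r in auto)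
      from sums_add[OF this sums_If_finite_set[of "{0::nat}" "\<lambda>_. Z2"]]
      have s1: "(\<lambda>m. r ^ m * (Z1 - Z2) + (if m \<in> {0} then Z2 else 0)) sums (1 / (1 - r) * (Z1 - Z2) + Z2)"
        by simp
      have s2: "(\<lambda>m. r ^ m * Z1) sums (1 / (1 - r) * Z1)"
        by (intro sums_mult2 geometric_sums) (use r in auto)
      have sm: "(\<lambda>m. r ^ m * t m) sums G"
      proof (cases "k \<in> T")
        case True
        then show ?thesis using s2 by (simp add: t_def G_def)
      next
        case False
        have "(\<lambda>m. r ^ m * (Z1 - Z2) + (if m \<in> {0} then Z2 else 0)) = (\<lambda>m. r ^ m * t m)"
          using False by (auto simp: t_def fun_eq_iff)
        moreover have "1 / (1 - r) * (Z1 - Z2) + Z2 = G" using False r by (simp add: G_def field_simps)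
        ultimately show ?thesis using s1 by simp
      qed
      have t0: "0 \<le> t m" for m
        by (rule has_sum_nonneg[OF tl]) (use assms(3) in auto)
      have "((\<lambda>m. r ^ m * t m) has_sum G) UNIV"
        by (rule sums_nonneg_imp_has_sum[OF sm]) (use r t0 in auto)
      note outer = this
      have inner: "((\<lambda>(xi, v). p ^ length xi * p ^ length v) has_sum r ^ m * t m) (blocks S k m \<times> tails S T k m)" for m
        by (rule has_sum_product_nonneg[OF bl tl]) (use assms in auto)
      have tot: "((\<lambda>(m, xi, v). p ^ length xi * p ^ length v) has_sum G) (SIGMA m:UNIV. blocks S k m \<times> tails S T k m)"
      proof (rule has_sum_SigmaI[OF _ outer])
        show "(\<lambda>(m, xi, v). p ^ length xi * p ^ length v) summable_on (SIGMA m:UNIV. blocks S k m \<times> tails S T k m)"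
          by (rule summable_on_SigmaI[OF _ has_sum_imp_summable[OF outer]])
            (use inner assms(3) in \<open>auto simp: split_def\<close>)
      qed (use inner in \<open>simp add: split_def\<close>)
      have "((\<lambda>w. p ^ length w) has_sum G) (PW S T)"
        unfolding PW_decomp[OF k(1-3)]
        by (subst has_sum_reindex[OF inj_on_decomp[OF k(1-3)]])
          (use tot in \<open>simp add: o_def split_def power_add\<close>)
      \<comment> \<open>If \<open>k\<close> is in \<open>T\<close>, deleting it does not change
        \<open>S - T\<close>; otherwise the numerator is the recursion of \<open>mu\<close> for
        \<open>S - T\<close>.\<close>
      moreover have "G = mu R (S - T) p / M"
      proof (cases "k \<in> T")
        case True
        then have "?S1 - T = S - T" by auto
        then show ?thesis using True Mpos by (simp add: G_def r1 Z1_def)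
      next
        case False
        have e: "S - T - {k} = ?S1 - T" "S - T - Lnb R n k = ?S2 - T" by auto
        have "mu R (S - T) p = mu R (?S1 - T) p - p * mu R (?S2 - T) p"
          using mu_rec[of k "S - T" p] False k unfolding e by auto
        moreover have "r * Z2 = p * mu R (?S2 - T) p / M1" using Mpos by (simp add: r_def Z2_def)
        ultimately have "Z1 - r * Z2 = mu R (S - T) p / M1" by (simp add: Z1_def diff_divide_distrib)
        then show ?thesis using False Mpos by (simp add: G_def r1)
      qed
      ultimately show ?thesis by (simp add: M_def)
    qed
  qed
  then show ?thesis using assms by blast
qed

section \<open>Length counts and their power series\<close>

definition npw :: "nat set \<Rightarrow> nat set \<Rightarrow> nat \<Rightarrow> nat" where
  "npw S T m = card {w \<in> PW S T. length w = m}"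

lemma finite_PW_length: "finite S \<Longrightarrow> finite {w \<in> PW S T. length w = m}"
  by (rule finite_subset[OF _ finite_lists_length_eq[of S m]]) (auto simp: PW_def)

text \<open>Grouping the words by length makes their generating function a power series in
  \<open>p\<close>, to which termwise differentiation applies.\<close>

lemma npw_sums:
  fixes p :: real
  assumes "S \<subseteq> {1..n}" "mu_pos S p" "0 \<le> p"
  shows "(\<lambda>m. real (npw S T m) * p ^ m) sums (mu R (S - T) p / mu R S p)"
proof -
  have fin: "finite S" using assms(1) finite_subset by blast
  let ?W = "\<lambda>m. {w \<in> PW S T. length w = m}"
  have bij: "bij_betw snd (SIGMA m:UNIV. ?W m) (PW S T)"
    by (auto simp: bij_betw_def inj_on_def image_iff)
  have "((\<lambda>(m, w). p ^ length w) has_sum (mu R (S - T) p / mu R S p)) (SIGMA m:UNIV. ?W m)"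
    using has_sum_reindex_bij_betw[OF bij, of "\<lambda>w. p ^ length w"] PW_has_sum[OF assms, of T]
    by (simp add: split_def)
  then have "((\<lambda>m. real (npw S T m) * p ^ m) has_sum (mu R (S - T) p / mu R S p)) UNIV"
  proof (rule has_sum_SigmaD)
    fix m :: nat
    show "((\<lambda>w. (case (m, w) of (m, w) \<Rightarrow> p ^ length w)) has_sum real (npw S T m) * p ^ m) (?W m)"
      using has_sum_finite[OF finite_PW_length[OF fin], of "\<lambda>w. p ^ length w" T m]
      by (simp add: npw_def)
  qed
  then show ?thesis by (rule has_sum_imp_sums)
qed

end

text \<open>A factor \<open>m\<close> is absorbed by any strictly smaller radius, since termwise
  differentiation keeps the disc of convergence.\<close>

lemma summable_mult_index:
  fixes a :: "nat \<Rightarrow> real"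
  assumes "summable (\<lambda>m. a m * K ^ m)" "\<bar>x\<bar> < \<bar>K\<bar>"
  shows "summable (\<lambda>m. real m * a m * x ^ m)"
proof -
  have "summable (\<lambda>m. diffs a m * x ^ m)"
  proof (rule termdiff_converges)
    show "norm x < \<bar>K\<bar>" using assms(2) by simp
    fix y :: real assume "norm y < \<bar>K\<bar>"
    then show "summable (\<lambda>m. a m * y ^ m)" using powser_inside[OF assms(1), of y] by simp
  qed
  from summable_mult[OF this, of x] have "summable (\<lambda>m. real (Suc m) * a (Suc m) * x ^ Suc m)"
    by (simp add: diffs_def mult_ac)
  then show ?thesis by (subst (asm) summable_Suc_iff)
qed

context dependence begin

text \<open>Multiplying the \<open>m\<close>-th term by \<open>m\<close> amounts to \<open>p\<close>
  times the derivative of \<open>mu R (S - T) / mu R S\<close>; the quotient rule writes it as the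
  function times its logarithmic derivative.\<close>

lemma npw_length_sums:
  fixes p :: real
  assumes "S \<subseteq> {1..n}" "mu_pos S p'" "0 < p" "p < p'"
  shows "(\<lambda>m. real m * real (npw S T m) * p ^ m) sums
     (mu R (S - T) p / mu R S p *
       (p * (deriv (mu R (S - T)) p / mu R (S - T) p - deriv (mu R S) p / mu R S p)))"
    and "summable (\<lambda>m. (real m)\<^sup>2 * real (npw S T m) * p ^ m)"
proof -
  let ?a = "\<lambda>m. real (npw S T m)"
  have sums: "(\<lambda>m. ?a m * x ^ m) sums (mu R (S - T) x / mu R S x)" if "x \<in> {0..p'}" for x
    using npw_sums[OF assms(1) mu_pos_mono[OF assms(2)]] that by simp
  have summ: "summable (\<lambda>m. ?a m * p' ^ m)" using sums[of p'] assms by (auto simp: sums_iff)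
  \<comment> \<open>An intermediate radius, because the factor \<open>m\<close> has to be absorbed
    twice.\<close>
  obtain q where q: "p < q" "q < p'" using dense assms(4) by blast
  have "summable (\<lambda>m. real m * ?a m * q ^ m)" using summable_mult_index[OF summ] q assms by simp
  from summable_mult_index[OF this, of p] show "summable (\<lambda>m. (real m)\<^sup>2 * ?a m * p ^ m)"
    using q assms by (simp add: power2_eq_square mult_ac)
  define D where "D = (\<Sum>m. diffs ?a m * p ^ m)"
  have der: "DERIV (\<lambda>x. \<Sum>m. ?a m * x ^ m) p :> D"
    unfolding D_def by (rule termdiffs_strong[OF summ]) (use assms in auto)
  have ev: "\<forall>\<^sub>F x in nhds p. (\<Sum>m. ?a m * x ^ m) = mu R (S - T) x / mu R S x"
    using eventually_nhds_in_open[of "{0<..<p'}" p] assms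
    by (auto elim!: eventually_mono simp: sums_iff[THEN iffD1, OF sums])
  have D1: "DERIV (\<lambda>x. mu R (S - T) x / mu R S x) p :> D"
    by (rule DERIV_cong_ev[OF refl ev refl, THEN iffD1, OF der])
  have pos: "0 < mu R S p" "0 < mu R (S - T) p"
    using mu_posD[OF mu_pos_mono[OF assms(2)], of p]
      mu_posD[OF mu_pos_mono[OF mu_pos_subset[OF assms(1,2)]], of "S - T" p] assms by auto
  have d: "DERIV (mu R X) p :> deriv (mu R X) p" for X
    using mu_differentiable field_differentiable_derivI by blast
  have "DERIV (\<lambda>x. mu R (S - T) x / mu R S x) p :>
     (deriv (mu R (S - T)) p * mu R S p - mu R (S - T) p * deriv (mu R S) p) / (mu R S p * mu R S p)"
    by (rule DERIV_divide[OF d d]) (use pos in auto)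
  then have D2: "D = (deriv (mu R (S - T)) p * mu R S p - mu R (S - T) p * deriv (mu R S) p) / (mu R S p * mu R S p)"
    using D1 DERIV_unique by blast
  have "summable (\<lambda>m. diffs ?a m * p ^ m)"
  proof (rule termdiff_converges)
    show "norm p < \<bar>p'\<bar>" using assms by simp
    fix y :: real assume "norm y < \<bar>p'\<bar>"
    then show "summable (\<lambda>m. ?a m * y ^ m)" using powser_inside[OF summ, of y] by simp
  qed
  then have "(\<lambda>m. p * (diffs ?a m * p ^ m)) sums (p * D)"
    unfolding D_def by (intro sums_mult summable_sums)
  then have "(\<lambda>m. real (Suc m) * ?a (Suc m) * p ^ Suc m) sums (p * D)"
    by (simp add: diffs_def mult_ac)
  \<comment> \<open>The differentiated series starts at \<open>m = 1\<close>; the term at 0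
    vanishes.\<close>
  then have "(\<lambda>m. real m * ?a m * p ^ m) sums (p * D)"
    by (subst (asm) sums_Suc_iff) simp
  moreover have "p * D = mu R (S - T) p / mu R S p *
       (p * (deriv (mu R (S - T)) p / mu R (S - T) p - deriv (mu R S) p / mu R S p))"
    using pos unfolding D2 by (simp add: field_simps)
  ultimately show "(\<lambda>m. real m * ?a m * p ^ m) sums
     (mu R (S - T) p / mu R S p *
       (p * (deriv (mu R (S - T)) p / mu R (S - T) p - deriv (mu R S) p / mu R S p)))" by simp
qed

end

section \<open>The repeat loop\<close>

lemma nn_integral_bind_spmf:
  "(\<integral>\<^sup>+ y. f y \<partial>measure_spmf (bind_spmf p g))
     = (\<integral>\<^sup>+ x. \<integral>\<^sup>+ y. f y \<partial>measure_spmf (g x) \<partial>measure_spmf p)"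
  unfolding measure_spmf_bind
  by (subst nn_integral_bind[where B = "count_space UNIV"])
     (auto simp: space_subprob_algebra)

lemma nn_integral_return_spmf [simp]:
  "(\<integral>\<^sup>+ y. f y \<partial>measure_spmf (return_spmf x)) = f x"
proof -
  have "measure_spmf (return_spmf x) = measure_pmf (return_pmf x)"
    by (metis measure_spmf_spmf_of_pmf spmf_of_pmf_return_pmf)
  then show ?thesis by (simp add: nn_integral_return)
qed

lemma nn_integral_lossless_const:
  "lossless_spmf p \<Longrightarrow> (\<integral>\<^sup>+ x. k \<partial>measure_spmf p) = k"
  by (simp add: measure_spmf.emeasure_eq_measure lossless_spmf_def)

lemma nn_integral_bernoulli_bind_spmf:
  assumes "0 \<le> r" "r \<le> 1"
  shows "(\<integral>\<^sup>+ x. f x \<partial>measure_spmf (bind_spmf (spmf_of_pmf (bernoulli_pmf r)) g))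
     = ennreal r * (\<integral>\<^sup>+ x. f x \<partial>measure_spmf (g True))
     + ennreal (1 - r) * (\<integral>\<^sup>+ x. f x \<partial>measure_spmf (g False))"
  using assms unfolding nn_integral_bind_spmf measure_spmf_spmf_of_pmf
  by (simp add: mult.commute)

text \<open>Monotone convergence along the chain. It makes upper bounds on integrals admissible for
  fixed-point induction.\<close>

lemma nn_integral_lub_spmf_le:
  assumes chain: "Complete_Partial_Order.chain (ord_spmf (=)) Y" and Y: "Y \<noteq> {}"
    and le: "\<And>p. p \<in> Y \<Longrightarrow> (\<integral>\<^sup>+ x. f x \<partial>measure_spmf p) \<le> B"
  shows "(\<integral>\<^sup>+ x. f x \<partial>measure_spmf (lub_spmf Y)) \<le> B"
proof -
  let ?M = "count_space (set_spmf (lub_spmf Y))"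
  have "(\<integral>\<^sup>+ x. f x \<partial>measure_spmf (lub_spmf Y))
      = (\<integral>\<^sup>+ x. (SUP y\<in>Y. ennreal (spmf y x) * f x) \<partial>?M)"
    by (simp add: nn_integral_measure_spmf' ennreal_spmf_lub_spmf[OF chain Y] SUP_mult_right_ennreal)
  also have "\<dots> = (SUP y\<in>Y. \<integral>\<^sup>+ x. ennreal (spmf y x) * f x \<partial>?M)"
  proof (rule nn_integral_monotone_convergence_SUP_countable[OF Y])
    have "(\<lambda>i x. ennreal (spmf i x) * f x) ` Y
        = (\<lambda>g x. g x * f x) ` (\<lambda>p x. ennreal (spmf p x)) ` Y"
      by (simp add: image_image)
    also have "Complete_Partial_Order.chain (\<le>) \<dots>"
      using chain_ord_spmf_eqD[OF chain]
      by (rule chain_imageI) (auto simp: le_fun_def intro!: mult_right_mono)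
    finally show "Complete_Partial_Order.chain (\<le>) ((\<lambda>i x. ennreal (spmf i x) * f x) ` Y)" .
  qed simp
  also have "\<dots> \<le> B"
  proof (rule SUP_least)
    fix y assume y: "y \<in> Y"
    have "(\<integral>\<^sup>+ x. ennreal (spmf y x) * f x \<partial>?M)
        \<le> (\<integral>\<^sup>+ x. ennreal (spmf y x) * f x \<partial>count_space UNIV)"
      by (subst nn_integral_count_space_indicator) (auto intro!: nn_integral_mono split: split_indicator)
    also have "\<dots> = (\<integral>\<^sup>+ x. f x \<partial>measure_spmf y)" by (simp add: nn_integral_measure_spmf)
    finally show "(\<integral>\<^sup>+ x. ennreal (spmf y x) * f x \<partial>?M) \<le> B" using le[OF y] by simp
  qed
  finally show ?thesis .
qed

text \<open>Superharmonic functions dominate the expected exit value: the loop is a least fixed point,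
  so no termination argument is needed.\<close>
lemma nn_integral_rep_loop_le:
  fixes f :: "bool \<times> nat list \<times> nat \<Rightarrow> ennreal" and V :: "nat \<Rightarrow> ennreal"
  assumes r: "0 \<le> r" "r \<le> 1"
    and V: "\<And>acc. ennreal r * (\<integral>\<^sup>+ vs. (if stop (fst vs) then f (True, fst vs, acc + 3 * c + snd vs)
                     else V (acc + 3 * c + snd vs)) \<partial>measure_spmf sub)
          + ennreal (1 - r) * (\<integral>\<^sup>+ vs. f (False, fst vs, acc + 3 * c + snd vs) \<partial>measure_spmf sub)
        \<le> V acc"
  shows "(\<integral>\<^sup>+ x. f x \<partial>measure_spmf (rep_loop c r sub stop acc)) \<le> V acc"
proof -
  have acc_eq: "x + c + (c + y) + c = x + 3 * c + y" for x y :: nat by simp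
  \<comment> \<open>The accumulator is quantified inside the predicate because every further round
    changes it.\<close>
  define P where "P = (\<lambda>L :: nat \<Rightarrow> real \<Rightarrow> (nat list \<times> nat) spmf \<Rightarrow> (nat list \<Rightarrow> bool) \<Rightarrow> nat
       \<Rightarrow> (bool \<times> nat list \<times> nat) spmf.
     \<forall>acc. (\<integral>\<^sup>+ x. f x \<partial>measure_spmf (L c r sub stop acc)) \<le> V acc)"
  have "P rep_loop"
  proof (rule rep_loop.fixp_induct)
    show "spmf.admissible (\<lambda>L. P (curry (curry (curry (curry L)))))"
    proof (rule ccpo.admissibleI)
      fix A :: "(((((nat \<times> real) \<times> (nat list \<times> nat) spmf) \<times> (nat list \<Rightarrow> bool)) \<times> nat)
         \<Rightarrow> (bool \<times> nat list \<times> nat) spmf) set"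
      assume chain: "Complete_Partial_Order.chain (fun_ord (ord_spmf (=))) A"
        and A: "A \<noteq> {}" and le: "\<forall>L\<in>A. P (curry (curry (curry (curry L))))"
      show "P (curry (curry (curry (curry (fun_lub lub_spmf A)))))"
        unfolding P_def fun_lub_def curry_def
      proof (intro allI nn_integral_lub_spmf_le)
        fix acc
        show "Complete_Partial_Order.chain (ord_spmf (=)) {y. \<exists>f\<in>A. y = f ((((c, r), sub), stop), acc)}"
          by (rule chain_fun[OF chain])
      qed (use A le in \<open>auto simp: P_def curry_def\<close>)
    qed
  next
    show "P (\<lambda>_ _ _ _ _. return_pmf None)" by (simp add: P_def)
  next
    fix L assume L: "P L"
    show "P (\<lambda>a b c d e. spmf_of_pmf (bernoulli_pmf b) \<bind> (\<lambda>ba. c \<bind> (\<lambda>vs.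
        let acc' = e + a + (a + snd vs) + a in
        if \<not> ba \<or> d (fst vs) then return_spmf (ba, fst vs, acc') else L a b c d acc')))"
      unfolding P_def
    proof
      fix acc
      have "ennreal r * (\<integral>\<^sup>+ vs. integral\<^sup>N (measure_spmf
           (if stop (fst vs) then return_spmf (True, fst vs, acc + 3 * c + snd vs)
            else L c r sub stop (acc + 3 * c + snd vs))) f \<partial>measure_spmf sub)
         \<le> ennreal r * (\<integral>\<^sup>+ vs. (if stop (fst vs) then f (True, fst vs, acc + 3 * c + snd vs)
                     else V (acc + 3 * c + snd vs)) \<partial>measure_spmf sub)"
        using L by (intro mult_left_mono nn_integral_mono) (auto simp: P_def)
      then show "(\<integral>\<^sup>+ x. f x \<partial>measure_spmf (spmf_of_pmf (bernoulli_pmf r) \<bind> (\<lambda>ba. sub \<bind> (\<lambda>vs.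
        let acc' = acc + c + (c + snd vs) + c in
        if \<not> ba \<or> stop (fst vs) then return_spmf (ba, fst vs, acc') else L c r sub stop acc')))) \<le> V acc"
        unfolding nn_integral_bernoulli_bind_spmf[OF r]
        by (intro order_trans[OF _ V[of acc]] add_mono)
          (simp_all add: nn_integral_bind_spmf Let_def acc_eq)
    qed
  qed
  then show ?thesis by (simp add: P_def)
qed

text \<open>For bounded payoffs, both the supremum and the infimum of the value over the accumulator
  satisfy the fixed-point inequality of a contraction, so the value is constant.\<close>
lemma nn_integral_rep_loop_bounded:
  fixes f :: "bool \<times> nat list \<Rightarrow> ennreal"
  assumes r: "0 \<le> r" "r < 1" and f: "\<And>x. f x \<le> 1"
  shows "(\<integral>\<^sup>+ (b, v, s). f (b, v) \<partial>measure_spmf (rep_loop c r sub stop acc))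
       * ennreal (1 - r * measure (measure_spmf sub) {vs. \<not> stop (fst vs)})
     = ennreal r * (\<integral>\<^sup>+ vs. (if stop (fst vs) then f (True, fst vs) else 0) \<partial>measure_spmf sub)
     + ennreal (1 - r) * (\<integral>\<^sup>+ vs. f (False, fst vs) \<partial>measure_spmf sub)"
proof -
  have acc_eq: "x + c + (c + y) + c = x + 3 * c + y" for x y :: nat by simp
  define h where "h acc = (\<integral>\<^sup>+ (b, v, s). f (b, v) \<partial>measure_spmf (rep_loop c r sub stop acc))" for acc
  define q where "q = measure (measure_spmf sub) {vs. \<not> stop (fst vs)}"
  define e where "e = ennreal r * (\<integral>\<^sup>+ vs. (if stop (fst vs) then f (True, fst vs) else 0) \<partial>measure_spmf sub)
     + ennreal (1 - r) * (\<integral>\<^sup>+ vs. f (False, fst vs) \<partial>measure_spmf sub)"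
  have q: "0 \<le> q" "q \<le> 1" by (auto simp: q_def measure_spmf.subprob_measure_le_1)
  have cont: "(\<integral>\<^sup>+ vs. (if stop (fst vs) then 0 else t) \<partial>measure_spmf sub) = ennreal q * t" for t
  proof -
    have "(\<integral>\<^sup>+ vs. (if stop (fst vs) then 0 else t) \<partial>measure_spmf sub)
       = (\<integral>\<^sup>+ vs. t * indicator {vs. \<not> stop (fst vs)} vs \<partial>measure_spmf sub)"
      by (intro nn_integral_cong) (auto split: split_indicator)
    also have "\<dots> = t * ennreal q"
      by (subst nn_integral_cmult_indicator) (auto simp: q_def measure_spmf.emeasure_eq_measure)
    finally show ?thesis by (simp add: mult.commute)
  qed
  \<comment> \<open>One unfolding of the loop: \<open>e\<close> collects the payoffs of a stopping
    first round, the remaining integral is the restart.\<close>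
  have h_eq: "h acc = e + ennreal r * (\<integral>\<^sup>+ vs. (if stop (fst vs) then 0 else h (acc + 3 * c + snd vs))
      \<partial>measure_spmf sub)" for acc
  proof -
    have "h acc = ennreal r * (\<integral>\<^sup>+ vs. (if stop (fst vs) then f (True, fst vs) else 0)
              + (if stop (fst vs) then 0 else h (acc + 3 * c + snd vs)) \<partial>measure_spmf sub)
           + ennreal (1 - r) * (\<integral>\<^sup>+ vs. f (False, fst vs) \<partial>measure_spmf sub)"
      unfolding h_def
      by (subst rep_loop.simps, subst nn_integral_bernoulli_bind_spmf)
        (use r in \<open>auto simp: nn_integral_bind_spmf Let_def acc_eq
           intro!: arg_cong2[where f = "(+)"] arg_cong2[where f = "(*)"] nn_integral_cong\<close>)
    then show ?thesis by (subst (asm) nn_integral_add) (auto simp: e_def algebra_simps)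
  qed
  have h_le: "h acc \<le> 1" for acc
  proof -
    have "h acc \<le> (\<integral>\<^sup>+ _. 1 \<partial>measure_spmf (rep_loop c r sub stop acc))"
      unfolding h_def by (intro nn_integral_mono) (auto simp: f)
    also have "\<dots> \<le> 1" by (simp add: measure_spmf.subprob_emeasure_le_1)
    finally show ?thesis .
  qed
  define s where "s = (SUP a. h a)"
  define i where "i = (INF a. h a)"
  have s: "s \<le> 1" unfolding s_def by (intro SUP_least h_le)
  have bds: "i \<le> h acc" "h acc \<le> s" for acc by (auto simp: s_def i_def intro: SUP_upper INF_lower)
  have s_le: "s \<le> e + ennreal (r * q) * s"
    unfolding s_def
  proof (rule SUP_least)
    fix a
    show "h a \<le> e + ennreal (r * q) * (SUP a. h a)"
      unfolding s_def[symmetric]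
      apply (subst h_eq)
      using r q by (auto simp: cont[symmetric] ennreal_mult mult.assoc intro!: add_left_mono mult_left_mono nn_integral_mono bds)
  qed
  have i_ge: "e + ennreal (r * q) * i \<le> i"
    unfolding i_def
  proof (rule INF_greatest)
    fix a
    show "e + ennreal (r * q) * (INF a. h a) \<le> h a"
      unfolding i_def[symmetric]
      apply (subst h_eq)
      using r q by (auto simp: cont[symmetric] ennreal_mult mult.assoc intro!: add_left_mono mult_left_mono nn_integral_mono bds)
  qed
  have rq: "r * q < 1" "0 \<le> r * q"
    using r q mult_left_le[of q r] by auto
  have i1: "i \<le> s" using bds order_trans by blast
  \<comment> \<open>The bound by 1 makes all quantities finite, so both inequalities can be
    rearranged over the reals.\<close>
  obtain s' where s': "s = ennreal s'" "0 \<le> s'" using s by (cases s) (auto simp: top_unique)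
  obtain i' where i': "i = ennreal i'" "0 \<le> i'" using s i1 by (cases i) (auto simp: top_unique)
  have "e \<le> i" using i_ge le_iff_add order_trans by (metis add.commute le_add_same_cancel2 zero_le add_increasing2 order_refl)
  then obtain e' where e': "e = ennreal e'" "0 \<le> e'" using i' by (cases e) (auto simp: top_unique)
  have "s' \<le> e' + r * q * s'" using s_le rq s' e' by (simp add: ennreal_mult[symmetric] ennreal_plus[symmetric] del: ennreal_plus)
  moreover have "e' + r * q * i' \<le> i'" using i_ge rq i' e' by (simp add: ennreal_mult[symmetric] ennreal_plus[symmetric] del: ennreal_plus)
  moreover have "i' \<le> s'" using i1 i' s' by simp
  \<comment> \<open>With \<open>i' \<le> s'\<close> this closes a cycle of inequalities, so they are
    all equalities.\<close>
  ultimately have "s' * (1 - r * q) \<le> e'" "e' \<le> i' * (1 - r * q)" by (auto simp: algebra_simps)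
  moreover have "i' * (1 - r * q) \<le> s' * (1 - r * q)" using \<open>i' \<le> s'\<close> rq by (intro mult_right_mono) auto
  ultimately have "s' * (1 - r * q) = e'" "i' * (1 - r * q) = s' * (1 - r * q)" by linarith+
  then have se: "s' * (1 - r * q) = e'" "i' = s'" using rq by auto
  have "h acc = s" using bds[of acc] se s' i' by auto
  then have "h acc * ennreal (1 - r * q) = e"
    using se s' e' rq by (simp add: ennreal_mult[symmetric])
  then show ?thesis by (simp add: h_def e_def q_def)
qed

text \<open>With payoff 1, the total mass times \<open>1 - r * q\<close> equals
  \<open>r * (1 - q) + (1 - r)\<close>, which is again \<open>1 - r * q\<close> and
  positive.\<close>

lemma lossless_rep_loop:
  assumes "0 \<le> r" "r < 1" "lossless_spmf sub"
  shows "lossless_spmf (rep_loop c r sub stop acc)"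
proof -
  let ?L = "measure_spmf (rep_loop c r sub stop acc)"
  define q where "q = measure (measure_spmf sub) {vs. \<not> stop (fst vs)}"
  have q: "0 \<le> q" "q \<le> 1" by (auto simp: q_def measure_spmf.subprob_measure_le_1)
  have rq: "r * q < 1" using assms q mult_left_le[of q r] by auto
  have st: "(\<integral>\<^sup>+ vs. (if stop (fst vs) then 1 else 0) \<partial>measure_spmf sub) = ennreal (1 - q)"
  proof -
    have "(\<integral>\<^sup>+ vs. (if stop (fst vs) then 1 else 0) \<partial>measure_spmf sub)
       = (\<integral>\<^sup>+ vs. indicator (- {vs. \<not> stop (fst vs)}) vs \<partial>measure_spmf sub)"
      by (intro nn_integral_cong) (auto split: split_indicator)
    also have "\<dots> = ennreal (measure (measure_spmf sub) (- {vs. \<not> stop (fst vs)}))"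
      by (simp add: measure_spmf.emeasure_eq_measure)
    also have "measure (measure_spmf sub) (- {vs. \<not> stop (fst vs)}) = 1 - q"
      using assms(3) measure_spmf.finite_measure_compl[of "{vs. \<not> stop (fst vs)}" sub]
      by (simp add: q_def Compl_eq_Diff_UNIV lossless_spmf_def space_measure_spmf)
    finally show ?thesis .
  qed
  have "(\<integral>\<^sup>+ (b, v, s). 1 \<partial>?L) * ennreal (1 - r * q) = ennreal r * ennreal (1 - q) + ennreal (1 - r)"
    using nn_integral_rep_loop_bounded[OF assms(1,2), of "\<lambda>_. 1" c sub stop acc] assms(3)
    by (simp add: q_def[symmetric] st measure_spmf.emeasure_eq_measure lossless_spmf_def)
  also have "\<dots> = 1 * ennreal (1 - r * q)"
    using assms q
    by (simp add: ennreal_mult[symmetric] ennreal_plus[symmetric] del: ennreal_plus)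
       (simp add: algebra_simps)
  finally have "(\<integral>\<^sup>+ (b, v, s). 1 \<partial>?L) = 1"
    using rq by (metis ennreal_eq_0_iff ennreal_mult_cancel_left ennreal_neq_top linorder_not_less
      diff_gt_0_iff_gt mult.commute)
  then show ?thesis
    by (simp add: lossless_spmf_def measure_spmf.emeasure_eq_measure split_def)
qed

text \<open>The exit values follow the law of one round conditioned on stopping; for a lossless
  \<open>sub\<close> the factor on the left is the probability that a round stops.\<close>

lemma spmf_rep_loop:
  assumes "0 \<le> r" "r < 1"
  shows "spmf (map_spmf (\<lambda>(b, v, s). (b, v)) (rep_loop c r sub stop acc)) (b, v)
       * (1 - r * measure (measure_spmf sub) {vs. \<not> stop (fst vs)})
     = (if b then (if stop v then r else 0) else 1 - r) * spmf (map_spmf fst sub) v"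
proof -
  define q where "q = measure (measure_spmf sub) {vs. \<not> stop (fst vs)}"
  have q: "0 \<le> q" "q \<le> 1" by (auto simp: q_def measure_spmf.subprob_measure_le_1)
  have rq: "r * q < 1" using assms q mult_left_le[of q r] by auto
  let ?p = "map_spmf (\<lambda>(b, v, s). (b, v)) (rep_loop c r sub stop acc)"
  have 1: "ennreal (spmf ?p (b, v)) = (\<integral>\<^sup>+ (b', v', s). indicator {(b, v)} (b', v') \<partial>measure_spmf (rep_loop c r sub stop acc))"
    by (simp add: emeasure_spmf_single[symmetric] nn_integral_indicator[symmetric] o_def split_def del: nn_integral_indicator)
  have 2: "ennreal (spmf (map_spmf fst sub) v) = (\<integral>\<^sup>+ vs. indicator {v} (fst vs) \<partial>measure_spmf sub)"
    by (simp add: emeasure_spmf_single[symmetric] nn_integral_indicator[symmetric] o_def del: nn_integral_indicator)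
  have 3: "ennreal (spmf ?p (b, v)) * ennreal (1 - r * q)
    = ennreal r * (\<integral>\<^sup>+ vs. (if stop (fst vs) then indicator {(b, v)} (True, fst vs) else 0) \<partial>measure_spmf sub)
     + ennreal (1 - r) * (\<integral>\<^sup>+ vs. indicator {(b, v)} (False, fst vs) \<partial>measure_spmf sub)"
    unfolding 1 q_def by (rule nn_integral_rep_loop_bounded[OF assms]) (auto split: split_indicator)
  have 4: "(\<integral>\<^sup>+ vs. (if stop (fst vs) then indicator {(b, v)} (True, fst vs) else 0) \<partial>measure_spmf sub)
     = (if b \<and> stop v then ennreal (spmf (map_spmf fst sub) v) else 0)"
    unfolding 2 by (cases "b \<and> stop v") (auto intro!: nn_integral_cong nn_integral_zero' split: split_indicator)
  have 5: "(\<integral>\<^sup>+ vs. indicator {(b, v)} (False, fst vs) \<partial>measure_spmf sub)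
     = (if b then 0 else ennreal (spmf (map_spmf fst sub) v))"
    unfolding 2 by (cases b) (auto intro!: nn_integral_cong split: split_indicator)
  have "ennreal (spmf ?p (b, v) * (1 - r * q)) =
     ennreal ((if b then (if stop v then r else 0) else 1 - r) * spmf (map_spmf fst sub) v)"
    using 3 assms rq unfolding 4 5 by (auto simp: ennreal_mult)
  then show ?thesis using assms rq by (subst (asm) ennreal_inj) (auto simp: q_def)
qed

section \<open>One level of the recursion\<close>

text \<open>Only one intermediate value leads to \<open>y\<close>. Unique decomposition of words
  provides this situation below.\<close>

lemma spmf_bind_single:
  assumes "\<And>x. x \<in> set_spmf M \<Longrightarrow> x \<noteq> x0 \<Longrightarrow> spmf (f x) y = 0"
  shows "spmf (bind_spmf M f) y = spmf M x0 * spmf (f x0) y"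
proof -
  have "spmf (bind_spmf M f) y = (\<integral>x. indicator {x0} x * spmf (f x0) y \<partial>measure_spmf M)"
    unfolding spmf_bind
    by (intro integral_cong_AE) (use assms in \<open>auto simp: AE_measure_spmf_iff split: split_indicator\<close>)
  also have "\<dots> = spmf M x0 * spmf (f x0) y"
    by (simp add: spmf_conv_measure_spmf)
  finally show ?thesis .
qed

text \<open>The recursive calls are abstracted to \<open>sub1\<close> and \<open>sub2\<close>, so
  that law and cost of one level follow from facts about arbitrary subprograms.\<close>

definition A2_body :: "nat \<Rightarrow> (nat \<Rightarrow> nat) \<Rightarrow> real \<Rightarrow> (nat list \<Rightarrow> bool) \<Rightarrow> nat \<Rightarrow>
    (nat list \<times> nat) spmf \<Rightarrow> (nat list \<times> nat) spmf \<Rightarrow> (nat list \<times> nat) spmf" where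
  "A2_body c dcost r stop k sub1 sub2 =
     bind_spmf (rep_loop c r sub1 stop 0) (\<lambda>(b, vinf, s1).
     bind_spmf (if b then map_spmf (\<lambda>g. (Suc g, c + dcost (Suc g))) (spmf_of_pmf (geometric_pmf (1 - r)))
                else return_spmf (0, c + c)) (\<lambda>(K, s2).
     bind_spmf (rep_calls c K sub2 k) (\<lambda>(xi, s3).
     return_spmf (xi @ vinf, c + c + c + c + s1 + s2 + s3 + c + c))))"

lemma map_fst_A2_body:
  "map_spmf fst (A2_body c dcost r stop k sub1 sub2) =
     bind_spmf (map_spmf (\<lambda>(b, v, s). (b, v)) (rep_loop c r sub1 stop 0)) (\<lambda>(b, v).
     bind_spmf (if b then map_spmf Suc (spmf_of_pmf (geometric_pmf (1 - r))) else return_spmf 0) (\<lambda>K.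
     map_spmf (\<lambda>xi. xi @ v) (map_spmf fst (rep_calls c K sub2 k))))"
  unfolding A2_body_def map_spmf_conv_bind_spmf bind_spmf_assoc return_bind_spmf
  by (intro bind_spmf_cong refl)
    (simp add: split_def bind_spmf_assoc if_distrib[where f = "\<lambda>p. bind_spmf p _"] cong: if_cong
      del: bind_spmf_of_pmf)

lemma lossless_rep_calls: "lossless_spmf sub \<Longrightarrow> lossless_spmf (rep_calls c m sub k)"
  by (induction m) auto

lemma lossless_A2_body:
  assumes "0 \<le> r" "r < 1" "lossless_spmf sub1" "lossless_spmf sub2"
  shows "lossless_spmf (A2_body c dcost r stop k sub1 sub2)"
  unfolding A2_body_def using lossless_rep_loop[OF assms(1-3)] lossless_rep_calls[OF assms(4)]
  by (auto simp: split_def)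

lemma map_fst_rep_calls_Suc:
  "map_spmf fst (rep_calls c (Suc m) sub k) =
     map_spmf (\<lambda>(xi, v). xi @ v @ [k]) (pair_spmf (map_spmf fst (rep_calls c m sub k)) (map_spmf fst sub))"
  by (simp add: pair_spmf_alt_def map_spmf_conv_bind_spmf bind_spmf_assoc o_def)

text \<open>Total mass may be below 1, hence an inequality. Bounds of the form
  \<open>ennreal B\<close> also record finiteness.\<close>

lemma nn_integral_affine_le:
  fixes f g :: "'a \<Rightarrow> real"
  assumes "(\<integral>\<^sup>+ x. ennreal (f x) \<partial>measure_spmf M) \<le> ennreal B"
    and "\<And>x. 0 \<le> f x" "0 \<le> a" "0 \<le> b" "0 \<le> B" "\<And>x. g x \<le> a + b * f x"
  shows "(\<integral>\<^sup>+ x. ennreal (g x) \<partial>measure_spmf M) \<le> ennreal (a + b * B)"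
proof -
  have "(\<integral>\<^sup>+ x. ennreal (g x) \<partial>measure_spmf M) \<le> (\<integral>\<^sup>+ x. ennreal a + ennreal b * ennreal (f x) \<partial>measure_spmf M)"
    using assms by (intro nn_integral_mono)
      (simp add: ennreal_mult[symmetric] ennreal_plus[symmetric] ennreal_leI del: ennreal_plus)
  also have "\<dots> = (\<integral>\<^sup>+ x. ennreal a \<partial>measure_spmf M) + ennreal b * (\<integral>\<^sup>+ x. ennreal (f x) \<partial>measure_spmf M)"
    by (subst nn_integral_add) (auto simp: nn_integral_cmult)
  also have "\<dots> \<le> ennreal a + ennreal b * ennreal B"
  proof (intro add_mono mult_left_mono assms)
    show "(\<integral>\<^sup>+ x. ennreal a \<partial>measure_spmf M) \<le> ennreal a"
      using mult_left_mono[OF measure_spmf.subprob_emeasure_le_1[of M "space (measure_spmf M)"], of "ennreal a"]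
      by simp
  qed simp
  also have "\<dots> = ennreal (a + b * B)"
    using assms by (simp add: ennreal_mult)
  finally show ?thesis .
qed

lemma nn_integral_convex_comb_le:
  fixes X Y :: ennreal
  assumes "0 \<le> r" "r \<le> 1" "X \<le> ennreal x" "Y \<le> ennreal y" "0 \<le> x" "0 \<le> y" "r * x + (1 - r) * y \<le> z"
  shows "ennreal r * X + ennreal (1 - r) * Y \<le> ennreal z"
proof -
  have "ennreal r * X + ennreal (1 - r) * Y \<le> ennreal r * ennreal x + ennreal (1 - r) * ennreal y"
    by (intro add_mono mult_left_mono assms) auto
  also have "\<dots> = ennreal (r * x + (1 - r) * y)" using assms by (simp add: ennreal_mult)
  also have "\<dots> \<le> ennreal z" using assms by (intro ennreal_leI)
  finally show ?thesis .
qed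

section \<open>First and second moments of the cost\<close>

lemma rep_calls_mean:
  assumes "0 \<le> B" and sub: "(\<integral>\<^sup>+ vs. ennreal (real (snd vs)) \<partial>measure_spmf sub) \<le> ennreal B"
  shows "(\<integral>\<^sup>+ ws. ennreal (real (snd ws)) \<partial>measure_spmf (rep_calls c m sub k))
     \<le> ennreal (real c + real m * (2 * real c + B))"
proof (induction m)
  case (Suc m)
  have e: "real x + real c + real y + real c = real x + 2 * real c + real y" for x y by simp
  have 1: "(\<integral>\<^sup>+ vs. ennreal (real (snd ws) + 2 * real c + real (snd vs)) \<partial>measure_spmf sub)
      \<le> ennreal (real (snd ws) + 2 * real c + 1 * B)" for ws :: "nat list \<times> nat"
    by (rule nn_integral_affine_le[OF sub]) (use assms in auto)
  have "(\<integral>\<^sup>+ ws. ennreal (real (snd ws)) \<partial>measure_spmf (rep_calls c (Suc m) sub k))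
     = (\<integral>\<^sup>+ ws. \<integral>\<^sup>+ vs. ennreal (real (snd ws) + 2 * real c + real (snd vs)) \<partial>measure_spmf sub
        \<partial>measure_spmf (rep_calls c m sub k))"
    by (simp add: nn_integral_bind_spmf e)
  also have "\<dots> \<le> (\<integral>\<^sup>+ ws. ennreal (real (snd ws) + 2 * real c + 1 * B) \<partial>measure_spmf (rep_calls c m sub k))"
    by (intro nn_integral_mono 1)
  also have "\<dots> \<le> ennreal (2 * real c + B + 1 * (real c + real m * (2 * real c + B)))"
    by (rule nn_integral_affine_le[OF Suc]) (use assms in auto)
  also have "2 * real c + B + 1 * (real c + real m * (2 * real c + B)) = real c + real (Suc m) * (2 * real c + B)"
    by (simp add: algebra_simps)
  finally show ?case .
qed simp

text \<open>A bound quadratic in \<open>m\<close> is needed, since it is going to be integrated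
  against a geometric law.\<close>

lemma rep_calls_square:
  assumes "0 \<le> Q" and sub: "(\<integral>\<^sup>+ vs. ennreal ((real (snd vs))\<^sup>2) \<partial>measure_spmf sub) \<le> ennreal Q"
  shows "(\<integral>\<^sup>+ ws. ennreal ((real (snd ws))\<^sup>2) \<partial>measure_spmf (rep_calls c m sub k))
     \<le> ennreal ((9 * (real c)\<^sup>2 + 2 * Q) * (real m + 1)\<^sup>2)"
proof (induction m)
  case 0
  have "(real c)\<^sup>2 \<le> 9 * (real c)\<^sup>2 + 2 * Q" using assms(1) by simp
  then show ?case by (simp add: ennreal_leI)
next
  case (Suc m)
  have e: "real x + real c + real y + real c = real x + 2 * real c + real y" for x y by simp
  define M where "M = real m + 1"
  have M: "1 \<le> M" by (simp add: M_def)
  define H where "H = 9 * (real c)\<^sup>2 + 2 * Q"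
  have pt: "(x + 2 * real c + y)\<^sup>2 \<le> ((M + 1) / M * x\<^sup>2 + (M + 1) * (8 * (real c)\<^sup>2)) + (M + 1) * 2 * y\<^sup>2" for x y
  proof -
    define z where "z = 2 * real c + y"
    \<comment> \<open>The weights \<open>(M + 1) / M\<close> and \<open>M + 1\<close> are those for
      which the bound for \<open>M\<close> reproduces itself for \<open>M + 1\<close>.\<close>
    have "0 \<le> (x - M * z)\<^sup>2 / M" using M by simp
    also have "\<dots> = (M + 1) / M * x\<^sup>2 + (M + 1) * z\<^sup>2 - (x + z)\<^sup>2"
      using M by (simp add: field_simps power2_eq_square)
    finally have "(x + z)\<^sup>2 \<le> (M + 1) / M * x\<^sup>2 + (M + 1) * z\<^sup>2" by simp
    also have "z\<^sup>2 \<le> 8 * (real c)\<^sup>2 + 2 * y\<^sup>2"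
      using sum_squares_bound[of "2 * real c" y] by (simp add: z_def power2_eq_square algebra_simps)
    then have "(M + 1) * z\<^sup>2 \<le> (M + 1) * (8 * (real c)\<^sup>2 + 2 * y\<^sup>2)" using M by (intro mult_left_mono) auto
    finally show ?thesis by (simp add: z_def algebra_simps)
  qed
  have 1: "(\<integral>\<^sup>+ vs. ennreal ((real (snd ws) + 2 * real c + real (snd vs))\<^sup>2) \<partial>measure_spmf sub)
      \<le> ennreal (((M + 1) / M * (real (snd ws))\<^sup>2 + (M + 1) * (8 * (real c)\<^sup>2)) + (M + 1) * 2 * Q)" for ws :: "nat list \<times> nat"
    by (rule nn_integral_affine_le[OF sub]) (use assms M pt in auto)
  have "(\<integral>\<^sup>+ ws. ennreal ((real (snd ws))\<^sup>2) \<partial>measure_spmf (rep_calls c (Suc m) sub k))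
     = (\<integral>\<^sup>+ ws. \<integral>\<^sup>+ vs. ennreal ((real (snd ws) + 2 * real c + real (snd vs))\<^sup>2) \<partial>measure_spmf sub
        \<partial>measure_spmf (rep_calls c m sub k))"
    by (simp add: nn_integral_bind_spmf e)
  also have "\<dots> \<le> (\<integral>\<^sup>+ ws. ennreal (((M + 1) / M * (real (snd ws))\<^sup>2 + (M + 1) * (8 * (real c)\<^sup>2)) + (M + 1) * 2 * Q)
      \<partial>measure_spmf (rep_calls c m sub k))"
    by (intro nn_integral_mono 1)
  also have "\<dots> \<le> ennreal ((M + 1) * (8 * (real c)\<^sup>2 + 2 * Q) + (M + 1) / M * (H * M\<^sup>2))"
    unfolding H_def M_def
    by (rule nn_integral_affine_le[OF Suc]) (use assms in \<open>auto simp: algebra_simps\<close>)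
  also have "\<dots> \<le> ennreal (H * (M + 1)\<^sup>2)"
  proof (rule ennreal_leI)
    have "(M + 1) * (8 * (real c)\<^sup>2 + 2 * Q) \<le> (M + 1) * H" using M by (intro mult_left_mono) (auto simp: H_def)
    moreover have "(M + 1) / M * (H * M\<^sup>2) = (M + 1) * H * M" using M by (simp add: power2_eq_square)
    ultimately show "(M + 1) * (8 * (real c)\<^sup>2 + 2 * Q) + (M + 1) / M * (H * M\<^sup>2) \<le> H * (M + 1)\<^sup>2"
      by (simp add: power2_eq_square algebra_simps)
  qed
  finally show ?case by (simp add: H_def M_def add_ac)
qed

text \<open>The bonus on exits with \<open>b\<close> prepays the blocks computed afterwards. It
  makes stopping and continuing after \<open>R = 1\<close> equally expensive, so \<open>stop\<close>
  drops out and \<open>M\<close> only has to solve \<open>M = 3 * c + B + r * M\<close>.\<close>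

lemma rep_loop_mean:
  fixes c :: nat
  assumes r: "0 \<le> r" "r < 1" and "0 \<le> B"
    and sub: "(\<integral>\<^sup>+ vs. ennreal (real (snd vs)) \<partial>measure_spmf sub) \<le> ennreal B"
  defines "M \<equiv> (3 * real c + B) / (1 - r)"
  shows "(\<integral>\<^sup>+ (b, v, s). ennreal (real s + (if b then M else 0)) \<partial>measure_spmf (rep_loop c r sub stop acc))
     \<le> ennreal (real acc + M)"
proof (rule nn_integral_rep_loop_le[where V = "\<lambda>acc. ennreal (real acc + M)"])
  fix acc
  have M: "0 \<le> M" "M * (1 - r) = 3 * real c + B" using assms by (auto simp: M_def)
  have 1: "(\<integral>\<^sup>+ vs. ennreal (real (acc + 3 * c + snd vs) + m) \<partial>measure_spmf sub) \<le> ennreal (real acc + 3 * real c + m + 1 * B)"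
    if "0 \<le> m" for m
    by (rule nn_integral_affine_le[OF sub]) (use assms that in auto)
  show "ennreal r * (\<integral>\<^sup>+ vs. (if stop (fst vs)
        then (case (True, fst vs, acc + 3 * c + snd vs) of (b, v, s) \<Rightarrow> ennreal (real s + (if b then M else 0)))
        else ennreal (real (acc + 3 * c + snd vs) + M)) \<partial>measure_spmf sub) +
      ennreal (1 - r) * (\<integral>\<^sup>+ vs. (case (False, fst vs, acc + 3 * c + snd vs) of (b, v, s) \<Rightarrow>
        ennreal (real s + (if b then M else 0))) \<partial>measure_spmf sub) \<le> ennreal (real acc + M)"
    by (rule nn_integral_convex_comb_le[of r _ "real acc + 3 * real c + M + 1 * B" _ "real acc + 3 * real c + 0 + 1 * B"])
      (use 1[of M] 1[of 0] M r \<open>0 \<le> B\<close> in \<open>auto simp: algebra_simps\<close>)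
qed (use r in auto)

text \<open>A superharmonic bound quadratic in \<open>acc\<close>. After \<open>R = 1\<close>
  continuing is the dearer branch and costs at most \<open>W + 2 * e\<close>, after
  \<open>R = 0\<close> the cost is at most \<open>e\<close>; \<open>W\<close> is chosen so that
  \<open>(1 + r) * e + r * W\<close> returns to the bound.\<close>

lemma rep_loop_square:
  fixes c :: nat
  assumes r: "0 \<le> r" "r < 1" and "0 \<le> Q"
    and sub: "(\<integral>\<^sup>+ vs. ennreal ((real (snd vs))\<^sup>2) \<partial>measure_spmf sub) \<le> ennreal Q"
  defines "W \<equiv> 2 * (1 + r) * (18 * (real c)\<^sup>2 + 2 * Q) / (1 - r)\<^sup>2"
  shows "(\<integral>\<^sup>+ (b, v, s). ennreal ((real s)\<^sup>2) \<partial>measure_spmf (rep_loop c r sub stop acc))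
     \<le> ennreal (2 * (real acc)\<^sup>2 + W)"
proof (rule nn_integral_rep_loop_le[where V = "\<lambda>acc. ennreal (2 * (real acc)\<^sup>2 + W)"])
  fix acc :: nat
  define x where "x = real acc"
  define D where "D = 18 * (real c)\<^sup>2 + 2 * Q"
  have D: "0 \<le> D" using assms by (simp add: D_def)
  have W: "0 \<le> W" "W * (1 - r) = 2 * (1 + r) / (1 - r) * D"
    using assms by (auto simp: W_def D_def power2_eq_square)
  have pt: "(real (acc + 3 * c + y))\<^sup>2 \<le> (2 / (1 + r) * x\<^sup>2 + 2 / (1 - r) * (18 * (real c)\<^sup>2)) + 2 / (1 - r) * 2 * (real y)\<^sup>2" for y
  proof -
    define z where "z = 3 * real c + real y"
    \<comment> \<open>The weight \<open>2 / (1 + r)\<close> of \<open>x\<close> is compensated by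
      the total weight \<open>2 * r + (1 - r) = 1 + r\<close>, which restores the leading
      coefficient 2.\<close>
    have "0 \<le> ((1 - r) * x - (1 + r) * z)\<^sup>2 / ((1 + r) * (1 - r))" using r by simp
    also have "\<dots> = 2 / (1 + r) * x\<^sup>2 + 2 / (1 - r) * z\<^sup>2 - (x + z)\<^sup>2"
      using r by (simp add: divide_simps) (simp add: algebra_simps power2_eq_square)
    finally have "(x + z)\<^sup>2 \<le> 2 / (1 + r) * x\<^sup>2 + 2 / (1 - r) * z\<^sup>2" by simp
    also have "z\<^sup>2 \<le> 18 * (real c)\<^sup>2 + 2 * (real y)\<^sup>2"
      using sum_squares_bound[of "3 * real c" "real y"] by (simp add: z_def power2_eq_square algebra_simps)
    then have "2 / (1 - r) * z\<^sup>2 \<le> 2 / (1 - r) * (18 * (real c)\<^sup>2 + 2 * (real y)\<^sup>2)"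
      using r by (intro mult_left_mono) auto
    finally show ?thesis by (simp add: z_def x_def algebra_simps)
  qed
  define e where "e = 2 / (1 + r) * x\<^sup>2 + 2 / (1 - r) * D"
  have e: "0 \<le> e" using r D by (simp add: e_def)
  have e_eq: "2 / (1 + r) * x\<^sup>2 + 2 / (1 - r) * (18 * (real c)\<^sup>2) + 2 / (1 - r) * 2 * Q = e"
    by (simp add: e_def D_def algebra_simps)
  have 1: "(\<integral>\<^sup>+ vs. ennreal ((real (acc + 3 * c + snd vs))\<^sup>2) \<partial>measure_spmf sub) \<le> ennreal e"
    unfolding e_eq[symmetric] by (rule nn_integral_affine_le[OF sub]) (use assms pt in auto)
  have "(\<integral>\<^sup>+ vs. (if stop (fst vs) then ennreal ((real (acc + 3 * c + snd vs))\<^sup>2)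
        else ennreal (2 * (real (acc + 3 * c + snd vs))\<^sup>2 + W)) \<partial>measure_spmf sub)
      \<le> (\<integral>\<^sup>+ vs. ennreal (2 * (real (acc + 3 * c + snd vs))\<^sup>2 + W) \<partial>measure_spmf sub)"
    using W by (intro nn_integral_mono) (auto intro!: ennreal_leI simp del: ennreal_plus)
  also have "\<dots> \<le> ennreal (W + 2 * e)"
    by (rule nn_integral_affine_le[OF 1]) (use W e in auto)
  finally have 2: "(\<integral>\<^sup>+ vs. (if stop (fst vs) then ennreal ((real (acc + 3 * c + snd vs))\<^sup>2)
        else ennreal (2 * (real (acc + 3 * c + snd vs))\<^sup>2 + W)) \<partial>measure_spmf sub) \<le> ennreal (W + 2 * e)" .
  have "r * (W + 2 * e) + (1 - r) * e = (1 + r) * e + r * W" by (simp add: algebra_simps)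
  also have "(1 + r) * e = (1 + r) * (2 / (1 + r)) * x\<^sup>2 + (1 + r) * (2 / (1 - r)) * D"
    unfolding e_def by (simp only: distrib_left mult.assoc)
  also have "(1 + r) * (2 / (1 + r)) = 2"
    unfolding times_divide_eq_right by (rule nonzero_mult_div_cancel_left) (use r in simp)
  also have "(1 + r) * (2 / (1 - r)) * D = W * (1 - r)" unfolding W(2) by simp
  finally have 3: "r * (W + 2 * e) + (1 - r) * e \<le> 2 * x\<^sup>2 + W" by (simp add: algebra_simps)
  show "ennreal r * (\<integral>\<^sup>+ vs. (if stop (fst vs)
        then (case (True, fst vs, acc + 3 * c + snd vs) of (b, v, s) \<Rightarrow> ennreal ((real s)\<^sup>2))
        else ennreal (2 * (real (acc + 3 * c + snd vs))\<^sup>2 + W)) \<partial>measure_spmf sub) +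
      ennreal (1 - r) * (\<integral>\<^sup>+ vs. (case (False, fst vs, acc + 3 * c + snd vs) of (b, v, s) \<Rightarrow>
        ennreal ((real s)\<^sup>2)) \<partial>measure_spmf sub) \<le> ennreal (2 * (real acc)\<^sup>2 + W)"
    unfolding prod.case
    by (rule nn_integral_convex_comb_le[OF _ _ 2 1]) (use 3 W e r in \<open>auto simp: x_def\<close>)
qed (use r in auto)

lemma geometric_pmf_mean_Suc:
  assumes "0 \<le> r" "r < 1"
  shows "(\<integral>\<^sup>+ g. ennreal (real (Suc g)) \<partial>measure_pmf (geometric_pmf (1 - r))) = ennreal (1 / (1 - r))"
proof -
  have p: "1 - r \<in> {0<..1}" using assms by auto
  have int: "integrable (geometric_pmf (1 - r)) (\<lambda>g. real (Suc g))"
    using integrable_real_geometric_pmf[OF p] by simp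
  have "measure_pmf.expectation (geometric_pmf (1 - r)) (\<lambda>g. real (Suc g))
      = 1 + measure_pmf.expectation (geometric_pmf (1 - r)) real"
    using integrable_real_geometric_pmf[OF p] by simp
  also have "\<dots> = 1 / (1 - r)" using expectation_geometric_pmf[OF p] assms by (simp add: field_simps)
  finally show ?thesis using nn_integral_eq_integral[OF int] by simp
qed

text \<open>The shift by 2 is \<open>m + 1\<close> at \<open>m = Suc g\<close> from
  \<open>rep_calls_square\<close>. Having \<open>G\<close> at least 1 lets it dominate constants as
  well.\<close>

lemma geometric_pmf_square_bound:
  assumes "0 \<le> r" "r < 1"
  shows "\<exists>G\<ge>1. (\<integral>\<^sup>+ g. ennreal ((real g + 2)\<^sup>2) \<partial>measure_pmf (geometric_pmf (1 - r))) \<le> ennreal G"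
proof -
  have p: "1 - r \<in> {0<..1}" using assms by auto
  \<comment> \<open>Two radii between \<open>r\<close> and 1, one for each factor
    \<open>m\<close>.\<close>
  obtain q where q: "r < q" "q < 1" using dense assms(2) by blast
  obtain q' where q': "q < q'" "q' < 1" using dense q(2) by blast
  have "summable (\<lambda>m. 1 * q' ^ m)" using q q' assms by (simp add: summable_geometric)
  from summable_mult_index[OF this, of q] have s1: "summable (\<lambda>m. real m * q ^ m)" using q q' assms by simp
  from summable_mult_index[OF this, of r] have s2: "summable (\<lambda>m. real m * real m * r ^ m)" using q assms by simp
  from summable_mult_index[of "\<lambda>_. 1" q r] have s3: "summable (\<lambda>m. real m * r ^ m)"
    using q assms by (simp add: summable_geometric)
  have s4: "summable (\<lambda>m. r ^ m)" using assms by (simp add: summable_geometric)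
  have "summable (\<lambda>m. (real m * real m * r ^ m + 4 * (real m * r ^ m) + 4 * r ^ m) * (1 - r))"
    by (intro summable_mult2 summable_add summable_mult s2 s3 s4)
  then have s: "summable (\<lambda>m. (r ^ m * (1 - r)) * (real m + 2)\<^sup>2)"
    by (simp add: power2_eq_square algebra_simps)
  have "(\<integral>\<^sup>+ g. ennreal ((real g + 2)\<^sup>2) \<partial>measure_pmf (geometric_pmf (1 - r)))
     = (\<Sum>m. ennreal ((r ^ m * (1 - r)) * (real m + 2)\<^sup>2))"
    using p assms by (simp add: nn_integral_measure_pmf nn_integral_count_space_nat ennreal_mult)
  also have "\<dots> = ennreal (\<Sum>m. (r ^ m * (1 - r)) * (real m + 2)\<^sup>2)"
    by (rule suminf_ennreal2[OF _ s]) (use assms in auto)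
  also have "\<dots> \<le> ennreal (max 1 (\<Sum>m. (r ^ m * (1 - r)) * (real m + 2)\<^sup>2))" by (intro ennreal_leI) auto
  finally show ?thesis by (intro exI[of _ "max 1 (\<Sum>m. (r ^ m * (1 - r)) * (real m + 2)\<^sup>2)"]) auto
qed

lemma nn_integral_A2_body:
  "(\<integral>\<^sup>+ ws. f (snd ws) \<partial>measure_spmf (A2_body c dcost r stop k sub1 sub2)) =
    (\<integral>\<^sup>+ (b, v, s1). (if b then \<integral>\<^sup>+ g. \<integral>\<^sup>+ ws. f (6 * c + s1 + (c + dcost (Suc g)) + snd ws)
           \<partial>measure_spmf (rep_calls c (Suc g) sub2 k) \<partial>measure_pmf (geometric_pmf (1 - r))
        else f (6 * c + s1 + 2 * c + c)) \<partial>measure_spmf (rep_loop c r sub1 stop 0))"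
proof -
  have e: "c + c + c + c + s1 + s2 + s3 + c + c = 6 * c + s1 + s2 + s3" for s1 s2 s3 by simp
  show ?thesis unfolding A2_body_def nn_integral_bind_spmf e
    by (intro nn_integral_cong)
      (auto simp: split_def nn_integral_bind_spmf o_def mult_2 simp del: rep_calls.simps(2))
qed

lemma A2_body_mean:
  assumes r: "0 \<le> r" "r < 1" and B: "0 \<le> B" and dc: "\<forall>X. dcost X \<le> c * (X + 1)"
    and sub1: "(\<integral>\<^sup>+ vs. ennreal (real (snd vs)) \<partial>measure_spmf sub1) \<le> ennreal B"
    and sub2: "(\<integral>\<^sup>+ vs. ennreal (real (snd vs)) \<partial>measure_spmf sub2) \<le> ennreal B"
  shows "(\<integral>\<^sup>+ ws. ennreal (real (snd ws)) \<partial>measure_spmf (A2_body c dcost r stop k sub1 sub2))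
     \<le> ennreal (9 * real c + (3 * real c + B) / (1 - r))"
proof -
  \<comment> \<open>The same \<open>M\<close> as in \<open>rep_loop_mean\<close>: a block costs
    \<open>2 * c + B\<close> and another \<open>c\<close> for its share in drawing \<open>K\<close>,
    as much as one loop round, and there are \<open>1 / (1 - r)\<close> blocks on average. The fixed
    lines add up to \<open>9 * c\<close> in both branches.\<close>
  define M where "M = (3 * real c + B) / (1 - r)"
  have M: "0 \<le> M" using r B by (simp add: M_def)
  have g: "(\<integral>\<^sup>+ g. ennreal (real (Suc g)) \<partial>measure_spmf (spmf_of_pmf (geometric_pmf (1 - r)))) \<le> ennreal (1 / (1 - r))"
    using geometric_pmf_mean_Suc[OF r] by simp
  have dc': "real (dcost (Suc g)) \<le> real c * (real (Suc g) + 1)" for g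
    using dc[rule_format, of "Suc g"] by (metis of_nat_1 of_nat_add of_nat_le_iff of_nat_mult)
  have inner: "(\<integral>\<^sup>+ ws. ennreal (real (6 * c + s1 + (c + dcost (Suc g)) + snd ws)) \<partial>measure_spmf (rep_calls c (Suc g) sub2 k))
      \<le> ennreal ((8 * real c + real s1 + real c * real (Suc g)) + 1 * (real c + real (Suc g) * (2 * real c + B)))" for g s1
    by (rule nn_integral_affine_le[OF rep_calls_mean[OF B sub2]]) (use B dc'[of g] in \<open>auto simp: algebra_simps\<close>)
  have mid: "(\<integral>\<^sup>+ g. \<integral>\<^sup>+ ws. ennreal (real (6 * c + s1 + (c + dcost (Suc g)) + snd ws))
           \<partial>measure_spmf (rep_calls c (Suc g) sub2 k) \<partial>measure_pmf (geometric_pmf (1 - r)))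
      \<le> ennreal (9 * real c + real s1 + M)" for s1
  proof -
    have "(\<integral>\<^sup>+ g. \<integral>\<^sup>+ ws. ennreal (real (6 * c + s1 + (c + dcost (Suc g)) + snd ws))
           \<partial>measure_spmf (rep_calls c (Suc g) sub2 k) \<partial>measure_pmf (geometric_pmf (1 - r)))
       \<le> (\<integral>\<^sup>+ g. ennreal ((8 * real c + real s1 + real c * real (Suc g)) + 1 * (real c + real (Suc g) * (2 * real c + B)))
          \<partial>measure_spmf (spmf_of_pmf (geometric_pmf (1 - r))))"
      unfolding measure_spmf_spmf_of_pmf by (intro nn_integral_mono inner)
    also have "\<dots> \<le> ennreal ((9 * real c + real s1) + (3 * real c + B) * (1 / (1 - r)))"
      by (rule nn_integral_affine_le[OF g]) (use B r in \<open>auto simp: algebra_simps\<close>)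
    finally show ?thesis by (simp add: M_def)
  qed
  have "(\<integral>\<^sup>+ ws. ennreal (real (snd ws)) \<partial>measure_spmf (A2_body c dcost r stop k sub1 sub2))
     \<le> (\<integral>\<^sup>+ x. ennreal (9 * real c + 1 * (case x of (b, v, s1) \<Rightarrow> real s1 + (if b then M else 0)))
          \<partial>measure_spmf (rep_loop c r sub1 stop 0))"
    unfolding nn_integral_A2_body[where f = "\<lambda>s. ennreal (real s)"]
  proof (rule nn_integral_mono, clarify)
    fix b v s1
    show "(if b then \<integral>\<^sup>+ g. \<integral>\<^sup>+ ws. ennreal (real (6 * c + s1 + (c + dcost (Suc g)) + snd ws))
           \<partial>measure_spmf (rep_calls c (Suc g) sub2 k) \<partial>measure_pmf (geometric_pmf (1 - r))
        else ennreal (real (6 * c + s1 + 2 * c + c))) \<le> ennreal (9 * real c + 1 * (real s1 + (if b then M else 0)))"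
      using mid[of s1] by (auto simp del: ennreal_plus rep_calls.simps simp: add_ac)
  qed
  also have "\<dots> \<le> ennreal (9 * real c + 1 * M)"
  proof (rule nn_integral_affine_le)
    show "(\<integral>\<^sup>+ x. ennreal (case x of (b, v, s1) \<Rightarrow> real s1 + (if b then M else 0)) \<partial>measure_spmf (rep_loop c r sub1 stop 0)) \<le> ennreal M"
      using rep_loop_mean[OF r B sub1, of c stop 0] unfolding M_def[symmetric] by (simp add: split_def)
  qed (use M in auto)
  finally show ?thesis by (simp add: M_def)
qed

text \<open>Only finiteness is wanted. The cost is cut into fixed lines, loop, draw and calls, whose
  squares are bounded separately at the price of a factor 4.\<close>

lemma A2_body_square:
  assumes r: "0 \<le> r" "r < 1" and Q: "0 \<le> Q" and dc: "\<forall>X. dcost X \<le> c * (X + 1)"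
    and sub1: "(\<integral>\<^sup>+ vs. ennreal ((real (snd vs))\<^sup>2) \<partial>measure_spmf sub1) \<le> ennreal Q"
    and sub2: "(\<integral>\<^sup>+ vs. ennreal ((real (snd vs))\<^sup>2) \<partial>measure_spmf sub2) \<le> ennreal Q"
  shows "\<exists>Q'\<ge>0. (\<integral>\<^sup>+ ws. ennreal ((real (snd ws))\<^sup>2) \<partial>measure_spmf (A2_body c dcost r stop k sub1 sub2)) \<le> ennreal Q'"
proof -
  obtain G where G: "1 \<le> G"
    "(\<integral>\<^sup>+ g. ennreal ((real g + 2)\<^sup>2) \<partial>measure_spmf (spmf_of_pmf (geometric_pmf (1 - r)))) \<le> ennreal G"
    using geometric_pmf_square_bound[OF r] by auto
  define H where "H = 9 * (real c)\<^sup>2 + 2 * Q"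
  define W where "W = 2 * (1 + r) * (18 * (real c)\<^sup>2 + 2 * Q) / (1 - r)\<^sup>2"
  \<comment> \<open>The total coefficient of \<open>(real g + 2)\<close> squared, from the draw and
    from the calls.\<close>
  define a where "a = 4 * (4 * (real c)\<^sup>2 + H)"
  have nn: "0 \<le> H" "0 \<le> W" "0 \<le> a" using Q r by (auto simp: H_def W_def a_def)
  have sq4: "(x + y + z + w)\<^sup>2 \<le> 4 * (x\<^sup>2 + y\<^sup>2 + z\<^sup>2 + w\<^sup>2)" for x y z w :: real
    using sum_squares_bound[of x y] sum_squares_bound[of x z] sum_squares_bound[of x w]
      sum_squares_bound[of y z] sum_squares_bound[of y w] sum_squares_bound[of z w]
    by (simp add: power2_eq_square algebra_simps)
  have dc': "(real (c + dcost (Suc g)))\<^sup>2 \<le> 4 * (real c)\<^sup>2 * (real g + 2)\<^sup>2" for g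
  proof -
    have "real (dcost (Suc g)) \<le> real c * (real (Suc g) + 1)"
      using dc[rule_format, of "Suc g"] by (metis of_nat_1 of_nat_add of_nat_le_iff of_nat_mult)
    then have "real (c + dcost (Suc g)) \<le> real c * (real g + 3)" by (simp add: algebra_simps)
    also have "\<dots> \<le> real c * (2 * (real g + 2))" by (intro mult_left_mono) auto
    finally have "(real (c + dcost (Suc g)))\<^sup>2 \<le> (real c * (2 * (real g + 2)))\<^sup>2" by (intro power_mono) auto
    also have "\<dots> = 4 * (real c)\<^sup>2 * (real g + 2)\<^sup>2" unfolding power_mult_distrib by simp
    finally show ?thesis .
  qed
  have inner: "(\<integral>\<^sup>+ ws. ennreal ((real (6 * c + s1 + (c + dcost (Suc g)) + snd ws))\<^sup>2) \<partial>measure_spmf (rep_calls c (Suc g) sub2 k))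
      \<le> ennreal (4 * (36 * (real c)\<^sup>2 + (real s1)\<^sup>2 + 4 * (real c)\<^sup>2 * (real g + 2)\<^sup>2) + 4 * (H * (real (Suc g) + 1)\<^sup>2))" for g s1
    unfolding H_def
  proof (rule nn_integral_affine_le[OF rep_calls_square[OF Q sub2]])
    fix ws :: "nat list \<times> nat"
    show "(real (6 * c + s1 + (c + dcost (Suc g)) + snd ws))\<^sup>2
       \<le> 4 * (36 * (real c)\<^sup>2 + (real s1)\<^sup>2 + 4 * (real c)\<^sup>2 * (real g + 2)\<^sup>2) + 4 * (real (snd ws))\<^sup>2"
      using sq4[of "6 * real c" "real s1" "real (c + dcost (Suc g))" "real (snd ws)"] dc'[of g]
      by (simp add: power_mult_distrib algebra_simps)
  qed (use Q in auto)
  have mid: "(\<integral>\<^sup>+ g. \<integral>\<^sup>+ ws. ennreal ((real (6 * c + s1 + (c + dcost (Suc g)) + snd ws))\<^sup>2)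
           \<partial>measure_spmf (rep_calls c (Suc g) sub2 k) \<partial>measure_pmf (geometric_pmf (1 - r)))
      \<le> ennreal (4 * (36 * (real c)\<^sup>2 + (real s1)\<^sup>2) + a * G)" for s1
  proof -
    have "(\<integral>\<^sup>+ g. \<integral>\<^sup>+ ws. ennreal ((real (6 * c + s1 + (c + dcost (Suc g)) + snd ws))\<^sup>2)
           \<partial>measure_spmf (rep_calls c (Suc g) sub2 k) \<partial>measure_pmf (geometric_pmf (1 - r)))
       \<le> (\<integral>\<^sup>+ g. ennreal (4 * (36 * (real c)\<^sup>2 + (real s1)\<^sup>2 + 4 * (real c)\<^sup>2 * (real g + 2)\<^sup>2) + 4 * (H * (real (Suc g) + 1)\<^sup>2))
          \<partial>measure_spmf (spmf_of_pmf (geometric_pmf (1 - r))))"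
      unfolding measure_spmf_spmf_of_pmf by (intro nn_integral_mono inner)
    also have "\<dots> \<le> ennreal (4 * (36 * (real c)\<^sup>2 + (real s1)\<^sup>2) + a * G)"
      by (rule nn_integral_affine_le[OF G(2)]) (use G(1) nn in \<open>auto simp: a_def algebra_simps\<close>)
    finally show ?thesis .
  qed
  have "(\<integral>\<^sup>+ ws. ennreal ((real (snd ws))\<^sup>2) \<partial>measure_spmf (A2_body c dcost r stop k sub1 sub2))
     \<le> (\<integral>\<^sup>+ x. ennreal ((144 * (real c)\<^sup>2 + a * G) + 4 * (case x of (b, v, s1) \<Rightarrow> (real s1)\<^sup>2))
          \<partial>measure_spmf (rep_loop c r sub1 stop 0))"
    unfolding nn_integral_A2_body[where f = "\<lambda>s. ennreal ((real s)\<^sup>2)"]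
  proof (rule nn_integral_mono, clarify)
    fix b v s1
    have "(real (6 * c + s1 + 2 * c + c))\<^sup>2 \<le> 4 * (36 * (real c)\<^sup>2 + (real s1)\<^sup>2 + 4 * (real c)\<^sup>2 + (real c)\<^sup>2)"
      using sq4[of "6 * real c" "real s1" "2 * real c" "real c"] by (simp add: power_mult_distrib)
    also have "\<dots> \<le> 144 * (real c)\<^sup>2 + 4 * (real s1)\<^sup>2 + a * 1"
      using Q by (simp add: a_def H_def)
    also have "\<dots> \<le> 144 * (real c)\<^sup>2 + 4 * (real s1)\<^sup>2 + a * G"
      using mult_left_mono[OF G(1) nn(3)] by simp
    finally have "ennreal ((real (6 * c + s1 + 2 * c + c))\<^sup>2) \<le> ennreal (144 * (real c)\<^sup>2 + 4 * (real s1)\<^sup>2 + a * G)"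
      by (rule ennreal_leI)
    moreover have "144 * (real c)\<^sup>2 + 4 * (real s1)\<^sup>2 + a * G = 144 * (real c)\<^sup>2 + a * G + 4 * (real s1)\<^sup>2"
      "4 * (36 * (real c)\<^sup>2 + (real s1)\<^sup>2) + a * G = 144 * (real c)\<^sup>2 + a * G + 4 * (real s1)\<^sup>2" by auto
    ultimately
    show "(if b then \<integral>\<^sup>+ g. \<integral>\<^sup>+ ws. ennreal ((real (6 * c + s1 + (c + dcost (Suc g)) + snd ws))\<^sup>2)
           \<partial>measure_spmf (rep_calls c (Suc g) sub2 k) \<partial>measure_pmf (geometric_pmf (1 - r))
        else ennreal ((real (6 * c + s1 + 2 * c + c))\<^sup>2)) \<le> ennreal ((144 * (real c)\<^sup>2 + a * G) + 4 * (real s1)\<^sup>2)"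
      using mid[of s1] by (cases b) (simp_all only: if_True if_False)
  qed
  also have "\<dots> \<le> ennreal ((144 * (real c)\<^sup>2 + a * G) + 4 * W)"
  proof (rule nn_integral_affine_le)
    show "(\<integral>\<^sup>+ x. ennreal (case x of (b, v, s1) \<Rightarrow> (real s1)\<^sup>2) \<partial>measure_spmf (rep_loop c r sub1 stop 0)) \<le> ennreal W"
      using rep_loop_square[OF r Q sub1, of c stop 0] by (simp add: W_def split_def)
  qed (use nn G(1) in auto)
  finally show ?thesis using nn G(1) by (intro exI[of _ "(144 * (real c)\<^sup>2 + a * G) + 4 * W"]) auto
qed

section \<open>Law and cost of the procedure\<close>

context dependence begin

text \<open>\<open>Z\<close> normalises a single call. Including the closing \<open>k\<close>, a
  block has weight \<open>p ^ length / (p * Z)\<close>, and the blocks are recovered uniquely from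
  their concatenation.\<close>

lemma spmf_rep_calls:
  fixes p Z :: real
  assumes k: "k \<in> S" "S \<subseteq> {1..k}" "k \<le> n" and p: "0 < p" "0 < Z"
    and sub: "\<And>v. spmf (map_spmf fst sub) v = (if v \<in> PW (S - {k}) (Lnb R n k) then p ^ length v / Z else 0)"
  shows "spmf (map_spmf fst (rep_calls c m sub k)) xi
     = (if xi \<in> blocks S k m then p ^ length xi / (p * Z) ^ m else 0)"
proof (induction m arbitrary: xi)
  case 0
  show ?case by (simp add: pmf_return)
next
  case (Suc m)
  let ?P = "pair_spmf (map_spmf fst (rep_calls c m sub k)) (map_spmf fst sub)"
  let ?f = "\<lambda>(xi, v). xi @ v @ [k]"
  have "set_spmf (map_spmf fst (rep_calls c m sub k)) = blocks S k m"
    using Suc p by (auto simp: set_eq_iff in_set_spmf_iff_spmf simp del: set_map_spmf)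
  moreover have "set_spmf (map_spmf fst sub) = PW (S - {k}) (Lnb R n k)"
    using sub p by (auto simp: set_eq_iff in_set_spmf_iff_spmf simp del: set_map_spmf)
  ultimately have set: "set_spmf ?P = blocks S k m \<times> PW (S - {k}) (Lnb R n k)"
    by (simp del: set_map_spmf)
  show ?case
  proof (cases "xi \<in> blocks S k (Suc m)")
    case True
    then obtain z v where xi: "xi = ?f (z, v)" and z: "z \<in> blocks S k m" and v: "v \<in> PW (S - {k}) (Lnb R n k)"
      by auto
    have "spmf (map_spmf fst (rep_calls c (Suc m) sub k)) xi = spmf ?P (z, v)"
      unfolding map_fst_rep_calls_Suc xi
      by (rule spmf_map_inj) (use inj_on_blocks[OF k] set z v in auto)
    also have "\<dots> = p ^ length z / (p * Z) ^ m * (p ^ length v / Z)"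
      by (simp add: Suc sub z v)
    also have "\<dots> = p ^ length xi / (p * Z) ^ Suc m"
      using p by (simp add: xi power_add)
    finally show ?thesis using True by simp
  next
    case False
    have "spmf (map_spmf fst (rep_calls c (Suc m) sub k)) xi = 0"
      unfolding map_fst_rep_calls_Suc
      by (rule spmf_map_outside) (use False set in auto)
    then show ?thesis using False by simp
  qed
qed

text \<open>A word has one decomposition \<open>xi @ v\<close>, so its probability is a product.
  With \<open>r = p * Z\<close>, the factors \<open>r\<close> from the loop,
  \<open>r ^ (m - 1)\<close> from the geometric draw and \<open>1 / r ^ m\<close> from the blocks
  cancel, and the same constant remains for every \<open>m\<close>. If \<open>r = 0\<close> instead,
  only \<open>m = 0\<close> can occur.\<close>

lemma A2_body_law:
  fixes p Z C r :: real
  assumes k: "k \<in> S" "S \<subseteq> {1..k}" "k \<le> n" and p: "0 < p" "0 < Z" "0 < C"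
    and r: "0 \<le> r" "r < 1" "r = p * Z \<or> r = 0 \<and> PW S T = PW (S - {k}) T"
    and sub1: "\<And>v. spmf (map_spmf fst sub1) v = (if v \<in> PW (S - {k}) T then C * p ^ length v else 0)"
    and sub2: "\<And>v. spmf (map_spmf fst sub2) v = (if v \<in> PW (S - {k}) (Lnb R n k) then p ^ length v / Z else 0)"
    and stop: "\<And>v. v \<in> PW (S - {k}) T \<Longrightarrow> stop v \<longleftrightarrow> k \<in> T \<or> (\<exists>c\<in>set v. R k c)"
  shows "\<exists>C'. \<forall>w. spmf (map_spmf fst (A2_body c dcost r stop k sub1 sub2)) w
     = (if w \<in> PW S T then C' * p ^ length w else 0)"
proof -
  define q where "q = measure (measure_spmf sub1) {vs. \<not> stop (fst vs)}"
  have q: "0 \<le> q" "q \<le> 1" by (auto simp: q_def measure_spmf.subprob_measure_le_1)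
  have rq: "0 < 1 - r * q" using r q mult_left_le[of q r] by auto
  define LW where "LW = map_spmf (\<lambda>(b, v, s). (b, v)) (rep_loop c r sub1 stop 0)"
  define Kd where "Kd b = (if b then map_spmf Suc (spmf_of_pmf (geometric_pmf (1 - r))) else return_spmf 0)" for b
  define X where "X m = map_spmf fst (rep_calls c m sub2 k)" for m
  define F where "F = (\<lambda>(b, v). bind_spmf (Kd b) (\<lambda>K. map_spmf (\<lambda>xi. xi @ v) (X K)))"
  have A: "map_spmf fst (A2_body c dcost r stop k sub1 sub2) = bind_spmf LW F"
    unfolding map_fst_A2_body LW_def F_def Kd_def X_def by simp
  have LW: "spmf LW (b, v) = (if b then if stop v then r else 0 else 1 - r) / (1 - r * q)
      * (if v \<in> PW (S - {k}) T then C * p ^ length v else 0)" for b v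
    using spmf_rep_loop[OF r(1,2), of c sub1 stop 0 b v] rq
    unfolding LW_def[symmetric] q_def[symmetric] sub1 by (simp add: field_simps)
  have X: "spmf (X m) xi = (if xi \<in> blocks S k m then p ^ length xi / (p * Z) ^ m else 0)" for m xi
    unfolding X_def by (rule spmf_rep_calls[OF k p(1,2) sub2])
  have setX: "set_spmf (X m) = blocks S k m" for m
    using X p by (auto simp: set_eq_iff in_set_spmf_iff_spmf)
  \<comment> \<open>An exit with \<open>b\<close> true requires \<open>stop v\<close>, which is the
    condition on tails preceded by blocks.\<close>
  have setLW: "v \<in> tails S T k (of_bool b) \<and> (b \<longrightarrow> r \<noteq> 0)" if "(b, v) \<in> set_spmf LW" for b v
  proof -
    have "spmf LW (b, v) \<noteq> 0" using that by (simp add: in_set_spmf_iff_spmf)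
    then show ?thesis unfolding LW using stop by (auto simp: tails_def split: if_splits)
  qed
  have setK: "b = (0 < m)" if "m \<in> set_spmf (Kd b)" for b m
    using that by (cases b) (auto simp: Kd_def)
  \<comment> \<open>Only whether \<open>m\<close> is zero matters, and that is what \<open>b\<close>
    records.\<close>
  have tails_cong: "tails S T k (of_bool (0 < m)) = tails S T k m" for m by (auto simp: tails_def)
  have kt: "k \<notin> set v" if "v \<in> tails S T k m" for v m using that by (auto simp: tails_def PW_def)
  \<comment> \<open>The constant as it appears for \<open>m = 0\<close>.\<close>
  define C' where "C' = (1 - r) / (1 - r * q) * C"
  have out: "w \<in> PW S T" if "w \<in> set_spmf (bind_spmf LW F)" for w
  proof -
    obtain b v m xi where w: "w = xi @ v" "(b, v) \<in> set_spmf LW" "m \<in> set_spmf (Kd b)" "xi \<in> blocks S k m"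
      using \<open>w \<in> set_spmf (bind_spmf LW F)\<close> by (auto simp: F_def setX set_bind_spmf bind_UNION)
    have v: "v \<in> tails S T k m" using setLW[OF w(2)] setK[OF w(3)] tails_cong by simp
    then show ?thesis unfolding PW_decomp[OF k] using w by force
  qed
  have inn: "spmf (bind_spmf LW F) w = C' * p ^ length w" if w: "w \<in> PW S T" for w
  proof -
    obtain m xi v where wv: "w = xi @ v" and xi: "xi \<in> blocks S k m" and v: "v \<in> tails S T k m"
      using w unfolding PW_decomp[OF k] by auto
    define b where "b = (0 < m)"
    have vP: "v \<in> PW (S - {k}) T" using v by (simp add: tails_def)
    have uniq: "m' = m \<and> xi' = xi \<and> v' = v" if "xi' @ v' = w" "xi' \<in> blocks S k m'" "v' \<in> tails S T k m''" for m' m'' xi' v'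
    proof -
      have "xi' = xi \<and> v' = v"
        by (rule append_block_inject[of _ _ _ _ k])
          (use that wv kt[OF v] kt[OF that(3)] blocksD(4)[OF xi k] blocksD(4)[OF that(2) k] in auto)
      then show ?thesis using blocksD(5)[OF xi k] blocksD(5)[OF that(2) k] by auto
    qed
    have 1: "spmf (bind_spmf LW F) w = spmf LW (b, v) * spmf (F (b, v)) w"
    proof (rule spmf_bind_single)
      fix x assume x: "x \<in> set_spmf LW" "x \<noteq> (b, v)"
      obtain b' v' where x': "x = (b', v')" by (cases x)
      have "w \<notin> set_spmf (F x)"
      proof
        assume "w \<in> set_spmf (F x)"
        then obtain m' xi' where m': "m' \<in> set_spmf (Kd b')" "xi' \<in> blocks S k m'" "xi' @ v' = w"
          by (auto simp: F_def setX x' set_bind_spmf bind_UNION)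
        then have "m' = m" "v' = v" using uniq setLW[of b' v'] x x' by blast+
        then show False using setK[OF m'(1)] x x' by (simp add: b_def)
      qed
      then show "spmf (F x) w = 0" by (simp add: in_set_spmf_iff_spmf)
    qed
    have 2: "spmf (F (b, v)) w = spmf (Kd b) m * spmf (map_spmf (\<lambda>xi. xi @ v) (X m)) w"
      unfolding F_def prod.case
    proof (rule spmf_bind_single)
      fix m' assume "m' \<noteq> m"
      then have "w \<notin> set_spmf (map_spmf (\<lambda>xi. xi @ v) (X m'))" using uniq v by (auto simp: setX)
      then show "spmf (map_spmf (\<lambda>xi. xi @ v) (X m')) w = 0" by (simp add: in_set_spmf_iff_spmf del: set_map_spmf)
    qed
    have 3: "spmf (map_spmf (\<lambda>xi. xi @ v) (X m)) w = p ^ length xi / (p * Z) ^ m"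
      unfolding wv using spmf_map_inj'[of "\<lambda>xi. xi @ v" "X m" xi] xi by (simp add: X inj_def)
    have eq: "spmf (bind_spmf LW F) w = spmf LW (b, v) * (spmf (Kd b) m * (p ^ length xi / (p * Z) ^ m))"
      by (simp add: 1 2 3)
    show ?thesis
    proof (cases m)
      case 0
      then have "xi = []" "b = False" using xi by (auto simp: b_def)
      then show ?thesis using 0 vP unfolding eq LW by (simp add: Kd_def C'_def wv pmf_return)
    next
      case (Suc j)
      then have b: "b = True" by (simp add: b_def)
      \<comment> \<open>In the alternative case the words of \<open>PW S T\<close> do not contain
        \<open>k\<close>, contrary to \<open>m > 0\<close>.\<close>
      have rp: "r = p * Z"
      proof (rule ccontr)
        assume "r \<noteq> p * Z"
        then have "w \<in> PW (S - {k}) T" using r(3) w by auto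
        then have "k \<notin> set w" by (auto simp: PW_def)
        then have "count_list xi k = 0" using wv by (simp add: count_list_0_iff)
        then show False using blocksD(5)[OF xi k] Suc by simp
      qed
      have st: "stop v" using v Suc stop[OF vP] by (auto simp: tails_def)
      have K: "spmf (Kd b) m = r ^ j * (1 - r)"
        using spmf_map_inj'[of Suc "spmf_of_pmf (geometric_pmf (1 - r))" j] b Suc r by (simp add: Kd_def)
      have "r \<noteq> 0" using rp p by simp
      have "spmf (bind_spmf LW F) w = r / (1 - r * q) * (C * p ^ length v) * (r ^ j * (1 - r) * (p ^ length xi / r ^ Suc j))"
        unfolding eq LW K using vP st b Suc rp by simp
      also have "\<dots> = C' * (p ^ length xi * p ^ length v)"
        using \<open>r \<noteq> 0\<close> rq by (simp add: C'_def field_simps)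
      finally show ?thesis by (simp add: wv power_add)
    qed
  qed
  show ?thesis
  proof (intro exI allI)
    fix w
    show "spmf (map_spmf fst (A2_body c dcost r stop k sub1 sub2)) w = (if w \<in> PW S T then C' * p ^ length w else 0)"
      unfolding A using inn[of w] out[of w] by (auto simp: in_set_spmf_iff_spmf)
  qed
qed

text \<open>A general \<open>f\<close> serves three purposes: the constant 1 for normalisation, the
  identity for the mean, the square for the variance.\<close>

lemma nn_integral_length_law:
  fixes p C :: real and A :: "(nat list \<times> nat) spmf"
  assumes "S \<subseteq> {1..n}" "0 \<le> p" "0 \<le> C"
    and law: "\<And>w. spmf (map_spmf fst A) w = (if w \<in> PW S T then C * p ^ length w else 0)"
    and f: "\<And>m. 0 \<le> f m" and s: "(\<lambda>m. f m * real (npw S T m) * p ^ m) sums s"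
  shows "(\<integral>\<^sup>+ ws. ennreal (f (length (fst ws))) \<partial>measure_spmf A) = ennreal (C * s)"
proof -
  have fin: "finite S" using assms(1) finite_subset by blast
  let ?L = "map_spmf length (map_spmf fst A)"
  have L: "spmf ?L m = C * real (npw S T m) * p ^ m" for m
  proof -
    let ?W = "{w \<in> PW S T. length w = m}"
    have "spmf ?L m = measure (measure_spmf (map_spmf fst A)) (length -` {m})" by (rule spmf_map)
    also have "\<dots> = measure (measure_spmf (map_spmf fst A)) ?W"
    proof (rule measure_spmf.finite_measure_eq_AE)
      show "AE x in measure_spmf (map_spmf fst A). x \<in> length -` {m} \<longleftrightarrow> x \<in> ?W"
        unfolding AE_measure_spmf_iff
        using law by (auto simp: in_set_spmf_iff_spmf simp del: set_map_spmf split: if_splits)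
    qed auto
    also have "\<dots> = (\<Sum>w\<in>?W. spmf (map_spmf fst A) w)"
      unfolding spmf_conv_measure_spmf
      by (rule measure_spmf.finite_measure_eq_sum_singleton) (use finite_PW_length[OF fin] in auto)
    also have "\<dots> = C * real (npw S T m) * p ^ m" by (simp add: law npw_def)
    finally show ?thesis .
  qed
  have "(\<integral>\<^sup>+ ws. ennreal (f (length (fst ws))) \<partial>measure_spmf A) = (\<integral>\<^sup>+ m. ennreal (f m) \<partial>measure_spmf ?L)"
    by (simp add: o_def)
  also have "\<dots> = (\<Sum>m. ennreal (spmf ?L m) * ennreal (f m))"
    by (simp only: nn_integral_measure_spmf nn_integral_count_space_nat)
  also have "\<dots> = (\<Sum>m. ennreal (C * (f m * real (npw S T m) * p ^ m)))"
    unfolding L using f assms by (intro suminf_cong) (simp add: ennreal_mult[symmetric] mult_ac)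
  also have "\<dots> = ennreal (C * s)"
    by (rule suminf_ennreal_eq) (use f assms s in \<open>auto intro: sums_mult\<close>)
  finally show ?thesis .
qed

text \<open>Total mass one determines the constant, so it need not be traced through the
  loop.\<close>

lemma law_const:
  fixes p C :: real and A :: "(nat list \<times> nat) spmf"
  assumes "S \<subseteq> {1..n}" "mu_pos S p" "0 \<le> p" and "lossless_spmf A"
    and law: "\<And>w. spmf (map_spmf fst A) w = (if w \<in> PW S T then C * p ^ length w else 0)"
  shows "C = mu R S p / mu R (S - T) p"
proof -
  have pos: "0 < mu R S p" "0 < mu R (S - T) p"
    using mu_posD[OF assms(2,3)] mu_posD[OF mu_pos_subset[OF assms(1,2)] assms(3), of "S - T"] by auto
  have "[] \<in> PW S T" by (simp add: PW_def)
  then have C: "0 \<le> C" using law[of "[]"] pmf_nonneg[of "map_spmf fst A" "Some []"] by simp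
  have "1 = (\<integral>\<^sup>+ ws. ennreal 1 \<partial>measure_spmf A)"
    using nn_integral_lossless_const[OF assms(4), of 1] by simp
  also have "\<dots> = ennreal (C * (mu R (S - T) p / mu R S p))"
    by (rule nn_integral_length_law[OF assms(1,3) C law]) (use npw_sums[OF assms(1-3)] in auto)
  finally have "C * (mu R (S - T) p / mu R S p) = 1" unfolding ennreal_1[symmetric]
    by (subst (asm) ennreal_inj) (use C pos in auto)
  then have "C * mu R (S - T) p = mu R S p" using pos(1) by (simp add: divide_eq_eq)
  then show ?thesis using pos(2) by (simp add: eq_divide_eq)
qed

section \<open>Recursion over the levels: the output law\<close>

lemma A2_Suc:
  "A2 c dcost R n p (Suc k') l =
    (if {1..Suc k'} \<inter> Lnb R n l = {} then return_spmf ([], c + c)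
     else A2_body c dcost
       (if comp R {1..Suc k'} (Suc k') \<inter> Lnb R n l \<noteq> {} then 1 - mu R {1..Suc k'} p / mu R {1..k'} p else 0)
       (\<lambda>v. Suc k' \<in> Lnb R n l \<or> tr R v \<notin> submon R ({1..k'} - Lnb R n (Suc k')))
       (Suc k') (A2 c dcost R n p k' l) (A2 c dcost R n p k' (Suc k')))"
  by (simp only: A2.simps A2_body_def Let_def)

lemma mu_interval_Suc:
  fixes p :: real
  assumes "Suc k' \<le> n" "mu_pos {1..Suc k'} p" "0 < p"
  shows "mu R {1..Suc k'} p = mu R {1..k'} p - p * mu R ({1..k'} - Lnb R n (Suc k')) p"
    "0 < mu R {1..Suc k'} p" "0 < mu R {1..k'} p" "0 < mu R ({1..k'} - Lnb R n (Suc k')) p"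
    "mu_pos {1..k'} p"
proof -
  have k: "Suc k' \<in> {1..Suc k'}" "{1..Suc k'} \<subseteq> {1..n}" using assms by auto
  have "Suc k' \<in> Lnb R n (Suc k')" using R_refl[of "Suc k'"] assms by (simp add: Lnb_def)
  then have e: "{1..Suc k'} - {Suc k'} = {1..k'}"
      "{1..Suc k'} - Lnb R n (Suc k') = {1..k'} - Lnb R n (Suc k')"
    by (auto simp: le_Suc_eq)
  show "mu R {1..Suc k'} p = mu R {1..k'} p - p * mu R ({1..k'} - Lnb R n (Suc k')) p"
    using mu_rec[OF k, of p] unfolding e .
  show pos: "mu_pos {1..k'} p" using mu_pos_subset[OF k(2) assms(2)] by auto
  have "{1..k'} - Lnb R n (Suc k') \<subseteq> {1..Suc k'}" by auto
  from mu_posD[OF mu_pos_subset[OF k(2) assms(2) this]]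
  show "0 < mu R {1..Suc k'} p" "0 < mu R {1..k'} p" "0 < mu R ({1..k'} - Lnb R n (Suc k')) p"
    using mu_posD[OF assms(2)] mu_posD[OF pos] assms(3)
    by auto
qed

lemma A2_law:
  fixes p :: real
  assumes "k \<le> n" "mu_pos {1..k} p" "0 < p"
  shows "lossless_spmf (A2 c dcost R n p k l)"
    and "spmf (map_spmf fst (A2 c dcost R n p k l)) w =
      (if w \<in> PW {1..k} (Lnb R n l) then mu R {1..k} p / mu R ({1..k} - Lnb R n l) p * p ^ length w else 0)"
proof -
  have "lossless_spmf (A2 c dcost R n p k l) \<and> (\<forall>w. spmf (map_spmf fst (A2 c dcost R n p k l)) w =
      (if w \<in> PW {1..k} (Lnb R n l) then mu R {1..k} p / mu R ({1..k} - Lnb R n l) p * p ^ length w else 0))"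
    using assms
  proof (induction k arbitrary: l)
    case 0
    then show ?case by (auto simp: PW_disjoint pmf_return)
  next
    case (Suc k')
    let ?k = "Suc k'" and ?S = "{1..Suc k'}" and ?T = "Lnb R n l"
    let ?A = "A2 c dcost R n p ?k l"
    note mu = mu_interval_Suc[OF Suc.prems]
    have S: "?k \<in> ?S" "?S \<subseteq> {1..?k}" "?S \<subseteq> {1..n}" using Suc.prems by auto
    have e: "?S - {?k} = {1..k'}" by auto
    have IH: "lossless_spmf (A2 c dcost R n p k' l)" "spmf (map_spmf fst (A2 c dcost R n p k' l)) w =
      (if w \<in> PW {1..k'} (Lnb R n l) then mu R {1..k'} p / mu R ({1..k'} - Lnb R n l) p * p ^ length w else 0)" for l w
      using Suc.IH[of l] Suc.prems mu(5) by auto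
    \<comment> \<open>The shape of the law comes first, with an unknown constant;
      \<open>law_const\<close> identifies it afterwards.\<close>
    have "lossless_spmf ?A \<and> (\<exists>C. \<forall>w. spmf (map_spmf fst ?A) w = (if w \<in> PW ?S ?T then C * p ^ length w else 0))"
    proof (cases "?S \<inter> ?T = {}")
      case True
      then show ?thesis unfolding A2_Suc by (auto simp: PW_disjoint pmf_return intro!: exI[of _ 1])
    next
      case False
      define r where "r = (if comp R ?S ?k \<inter> ?T \<noteq> {} then 1 - mu R ?S p / mu R {1..k'} p else 0)"
      define Z where "Z = mu R ({1..k'} - Lnb R n ?k) p / mu R {1..k'} p"
      have Z: "0 < Z" using mu by (simp add: Z_def)
      \<comment> \<open>By the recursion of \<open>mu\<close>, the bias used by the procedure is the
        weight of one block.\<close>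
      have rr: "1 - mu R ?S p / mu R {1..k'} p = p * Z" using mu by (simp add: Z_def field_simps)
      have "0 < mu R ?S p / mu R {1..k'} p" using mu by simp
      then have r: "0 \<le> r" "r < 1" using rr Z Suc.prems(3) by (auto simp: r_def)
      have r3: "r = p * Z \<or> r = 0 \<and> PW ?S ?T = PW (?S - {?k}) ?T"
        using PW_component[of ?S ?k ?T] S rr by (auto simp: r_def)
      let ?C = "mu R {1..k'} p / mu R ({1..k'} - ?T) p"
      have "{1..k'} - ?T \<subseteq> ?S" by auto
      from mu_posD[OF mu_pos_subset[OF S(3) Suc.prems(2) this]]
      have C: "0 < ?C" using mu(3) Suc.prems(3) by simp
      define stop where "stop = (\<lambda>v. ?k \<in> ?T \<or> tr R v \<notin> submon R ({1..k'} - Lnb R n ?k))"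
      \<comment> \<open>The letters of a word depend only on its trace, so the submonoid test
        becomes a test on letters.\<close>
      have st: "stop v \<longleftrightarrow> ?k \<in> ?T \<or> (\<exists>c\<in>set v. R ?k c)" if "v \<in> PW (?S - {?k}) ?T" for v
      proof -
        have "set v \<subseteq> {1..k'}" using that unfolding e by (auto simp: PW_def)
        then show ?thesis using Suc.prems(1) by (auto simp: stop_def tr_in_submon_iff Lnb_def subset_eq)
      qed
      have A: "?A = A2_body c dcost r stop ?k (A2 c dcost R n p k' l) (A2 c dcost R n p k' ?k)"
        using False unfolding A2_Suc r_def stop_def by simp
      have "\<exists>C. \<forall>w. spmf (map_spmf fst ?A) w = (if w \<in> PW ?S ?T then C * p ^ length w else 0)"
        unfolding A
        by (rule A2_body_law[where Z = Z and C = ?C and S = ?S and k = ?k])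
          (use S Suc.prems Z C r r3 IH st in \<open>simp_all add: e Z_def del: One_nat_def\<close>)
      moreover have "lossless_spmf ?A"
        unfolding A by (rule lossless_A2_body) (use r IH in auto)
      ultimately show ?thesis by blast
    qed
    then obtain C where ll: "lossless_spmf ?A"
      and C: "\<And>w. spmf (map_spmf fst ?A) w = (if w \<in> PW ?S ?T then C * p ^ length w else 0)" by blast
    have "C = mu R ?S p / mu R (?S - ?T) p"
      by (rule law_const[OF S(3) Suc.prems(2) _ ll C]) (use Suc.prems in auto)
    then show ?case using ll C by auto
  qed
  then show "lossless_spmf (A2 c dcost R n p k l)"
    and "spmf (map_spmf fst (A2 c dcost R n p k l)) w =
      (if w \<in> PW {1..k} (Lnb R n l) then mu R {1..k} p / mu R ({1..k} - Lnb R n l) p * p ^ length w else 0)"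
    by blast+
qed

section \<open>Running time\<close>

lemma mu_interval_le_1:
  fixes p :: real
  assumes "k \<le> n" "mu_pos {1..k} p" "0 < p"
  shows "mu R {1..k} p \<le> 1"
  using assms
proof (induction k)
  case (Suc k')
  note mu = mu_interval_Suc[OF Suc.prems]
  have "0 \<le> p * mu R ({1..k'} - Lnb R n (Suc k')) p" using mu(4) Suc.prems(3) by simp
  moreover have "mu R {1..k'} p \<le> 1" using Suc mu(5) by simp
  ultimately show ?case using mu(1) by linarith
qed simp

text \<open>The immediate return costs \<open>2 * c\<close>; each level adds \<open>9 * c\<close>
  for its fixed lines and \<open>3 * c\<close> per loop round, all measured against the current
  \<open>mu\<close>.\<close>

lemma A2_cost:
  fixes p :: real
  assumes "k \<le> n" "mu_pos {1..k} p" "0 < p" and dc: "\<forall>X. dcost X \<le> c * (X + 1)"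
  shows "(\<integral>\<^sup>+ ws. ennreal (real (snd ws)) \<partial>measure_spmf (A2 c dcost R n p k l))
      \<le> ennreal ((2 * real c + 12 * real c * real k) / mu R {1..k} p)"
    and "\<exists>Q\<ge>0. (\<integral>\<^sup>+ ws. ennreal ((real (snd ws))\<^sup>2) \<partial>measure_spmf (A2 c dcost R n p k l)) \<le> ennreal Q"
proof -
  have "(\<integral>\<^sup>+ ws. ennreal (real (snd ws)) \<partial>measure_spmf (A2 c dcost R n p k l))
      \<le> ennreal ((2 * real c + 12 * real c * real k) / mu R {1..k} p) \<and>
     (\<exists>Q\<ge>0. (\<integral>\<^sup>+ ws. ennreal ((real (snd ws))\<^sup>2) \<partial>measure_spmf (A2 c dcost R n p k l)) \<le> ennreal Q)"
    using assms(1-3)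
  proof (induction k arbitrary: l)
    case 0
    show ?case by (auto intro!: exI[of _ "(real c + real c)\<^sup>2"] simp del: ennreal_plus)
  next
    case (Suc k')
    let ?k = "Suc k'" and ?S = "{1..Suc k'}" and ?T = "Lnb R n l"
    note mu = mu_interval_Suc[OF Suc.prems]
    define m m' where "m = mu R ?S p" and "m' = mu R {1..k'} p"
    have m: "0 < m" "0 < m'" "m \<le> 1" "m' \<le> 1" "m \<le> m'"
      using mu mu_interval_le_1[OF Suc.prems] mu_interval_le_1[of k' p] Suc.prems by (auto simp: m_def m'_def)
    define B where "B = (2 * real c + 12 * real c * real k') / m'"
    define B' where "B' = (2 * real c + 12 * real c * real ?k) / m"
    have B: "0 \<le> B" using m by (simp add: B_def)
    have "x / 1 \<le> x / m" if "0 \<le> x" for x using that m by (intro divide_left_mono) auto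
    then have div: "x \<le> x / m" if "0 \<le> x" for x using that by simp
    have IH: "(\<integral>\<^sup>+ ws. ennreal (real (snd ws)) \<partial>measure_spmf (A2 c dcost R n p k' l)) \<le> ennreal B"
      "\<exists>Q\<ge>0. (\<integral>\<^sup>+ ws. ennreal ((real (snd ws))\<^sup>2) \<partial>measure_spmf (A2 c dcost R n p k' l)) \<le> ennreal Q" for l
      using Suc.IH[of l] Suc.prems mu(5) by (auto simp: B_def m'_def)
    show ?case
    proof (cases "?S \<inter> ?T = {}")
      case True
      have "2 * real c \<le> (2 * real c) / m" by (rule div) simp
      also have "\<dots> \<le> B'" unfolding B'_def using m by (intro divide_right_mono) auto
      finally have "ennreal (2 * real c) \<le> ennreal B'" by (rule ennreal_leI)
      then show ?thesis using True unfolding A2_Suc B'_def m_def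
        by (auto intro!: exI[of _ "(2 * real c)\<^sup>2"])
    next
      case False
      define r where "r = (if comp R ?S ?k \<inter> ?T \<noteq> {} then 1 - m / m' else 0)"
      define stop where "stop = (\<lambda>v. ?k \<in> ?T \<or> tr R v \<notin> submon R ({1..k'} - Lnb R n ?k))"
      have A: "A2 c dcost R n p ?k l = A2_body c dcost r stop ?k (A2 c dcost R n p k' l) (A2 c dcost R n p k' ?k)"
        using False unfolding A2_Suc r_def stop_def m_def m'_def by simp
      \<comment> \<open>The third bound is an equality when the component test succeeds and follows
        from \<open>m \<le> m'\<close> when \<open>r = 0\<close>.\<close>
      have r: "0 \<le> r" "r < 1" "m / m' \<le> 1 - r" using m by (auto simp: r_def)
      obtain Q1 where Q1: "0 \<le> Q1" "(\<integral>\<^sup>+ ws. ennreal ((real (snd ws))\<^sup>2) \<partial>measure_spmf (A2 c dcost R n p k' l)) \<le> ennreal Q1"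
        using IH(2) by blast
      obtain Q2 where Q2: "0 \<le> Q2" "(\<integral>\<^sup>+ ws. ennreal ((real (snd ws))\<^sup>2) \<partial>measure_spmf (A2 c dcost R n p k' ?k)) \<le> ennreal Q2"
        using IH(2) by blast
      have sq: "\<exists>Q'\<ge>0. (\<integral>\<^sup>+ ws. ennreal ((real (snd ws))\<^sup>2) \<partial>measure_spmf (A2 c dcost R n p ?k l)) \<le> ennreal Q'"
        unfolding A
        by (rule A2_body_square[OF r(1,2) _ dc, of "max Q1 Q2"])
          (use Q1 Q2 in \<open>auto intro: order_trans ennreal_leI\<close>)
      have "(\<integral>\<^sup>+ ws. ennreal (real (snd ws)) \<partial>measure_spmf (A2 c dcost R n p ?k l))
         \<le> ennreal (9 * real c + (3 * real c + B) / (1 - r))"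
        unfolding A by (rule A2_body_mean[OF r(1,2) B dc IH(1) IH(1)])
      also have "9 * real c + (3 * real c + B) / (1 - r) \<le> B'"
      proof -
        \<comment> \<open>The factor \<open>m' / m\<close> cancels the denominator \<open>m'\<close>
          of \<open>B\<close> and leaves \<open>m\<close>; this is where the bounds
          telescope.\<close>
        have "(3 * real c + B) / (1 - r) \<le> (3 * real c + B) / (m / m')"
          using r m B by (intro divide_left_mono) auto
        also have "\<dots> = (3 * real c * m' + (2 * real c + 12 * real c * real k')) / m"
          using m by (simp add: B_def field_simps)
        also have "\<dots> \<le> (3 * real c + (2 * real c + 12 * real c * real k')) / m"
          using m by (intro divide_right_mono add_right_mono mult_left_le) auto
        finally have "9 * real c + (3 * real c + B) / (1 - r)
            \<le> 9 * real c / m + (3 * real c + (2 * real c + 12 * real c * real k')) / m"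
          using div[of "9 * real c"] by simp
        also have "\<dots> = B'" by (simp add: B'_def add_divide_distrib[symmetric] algebra_simps)
        finally show ?thesis .
      qed
      finally show ?thesis using sq unfolding B'_def m_def by (simp add: ennreal_leI)
    qed
  qed
  then show "(\<integral>\<^sup>+ ws. ennreal (real (snd ws)) \<partial>measure_spmf (A2 c dcost R n p k l))
      \<le> ennreal ((2 * real c + 12 * real c * real k) / mu R {1..k} p)"
    and "\<exists>Q\<ge>0. (\<integral>\<^sup>+ ws. ennreal ((real (snd ws))\<^sup>2) \<partial>measure_spmf (A2 c dcost R n p k l)) \<le> ennreal Q"
    by blast+
qed

text \<open>The canonical words represent the conditioned traces bijectively and preserve lengths,
  so the word law is carried over point by point.\<close>

lemma trace_law:
  fixes p :: real
  assumes S: "S \<subseteq> {1..n}" and pos: "mu_pos S p" "0 \<le> p"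
    and law: "\<And>w. spmf (map_spmf fst A) w =
       (if w \<in> PW S T then mu R S p / mu R (S - T) p * p ^ length w else 0)"
  shows "spmf (map_spmf (\<lambda>ws. tr R (fst ws)) A) x = Dprob R S T p x"
proof -
  let ?W = "map_spmf fst A"
  have mp: "0 < mu R S p" using mu_posD[OF pos] .
  have set: "set_spmf ?W \<subseteq> PW S T"
    using law by (auto simp: in_set_spmf_iff_spmf simp del: set_map_spmf split: if_splits)
  have inj: "inj_on (tr R) (PW S T)" by (rule inj_on_tr_PW[OF S])
  have map: "map_spmf (\<lambda>ws. tr R (fst ws)) A = map_spmf (tr R) ?W"
    by (simp add: spmf.map_comp o_def)
  \<comment> \<open>The conditioning probability: the factor \<open>mu R S p\<close> of
    \<open>Bprob\<close> cancels the denominator in \<open>PW_has_sum\<close>.\<close>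
  have norm: "(\<Sum>\<^sub>\<infinity> y \<in> {y. tmax y \<subseteq> T}. Bprob R S p y) = mu R (S - T) p"
  proof -
    have "(\<Sum>\<^sub>\<infinity> y \<in> {y. tmax y \<subseteq> T}. Bprob R S p y) = (\<Sum>\<^sub>\<infinity> y \<in> tr R ` PW S T. Bprob R S p y)"
      unfolding tr_PW[OF S] by (rule infsum_cong_neutral) (auto simp: Bprob_def)
    also have "\<dots> = (\<Sum>\<^sub>\<infinity> w \<in> PW S T. mu R S p * p ^ length w)"
    proof (subst infsum_reindex[OF inj], rule infsum_cong)
      fix w assume "w \<in> PW S T"
      then show "(Bprob R S p \<circ> tr R) w = mu R S p * p ^ length w"
        by (auto simp: Bprob_def tlen_tr tr_in_submon_iff PW_def)
    qed
    also have "\<dots> = mu R S p * (mu R (S - T) p / mu R S p)"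
      by (rule infsumI) (rule has_sum_cmult_right[OF PW_has_sum[OF S pos]])
    finally show ?thesis using mp by simp
  qed
  show ?thesis
  proof (cases "x \<in> tr R ` PW S T")
    case True
    then obtain w where w: "w \<in> PW S T" "x = tr R w" by blast
    have "spmf (map_spmf (tr R) ?W) (tr R w) = spmf ?W w"
    proof (cases "w \<in> set_spmf ?W")
      case True
      then show ?thesis by (rule spmf_map_inj[OF inj_on_subset[OF inj set]])
    next
      case False
      then have "tr R w \<notin> tr R ` set_spmf ?W" using inj_on_image_mem_iff[OF inj w(1) set] by blast
      from spmf_map_outside[OF this] show ?thesis using False by (simp add: in_set_spmf_iff_spmf del: set_map_spmf)
    qed
    moreover have "tmax x \<subseteq> T" "x \<in> submon R S" using True tr_PW[OF S, of T] by auto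
    ultimately show ?thesis unfolding map Dprob_def norm using w law[of w] by (simp add: Bprob_def tlen_tr)
  next
    case False
    have "spmf (map_spmf (tr R) ?W) x = 0" by (rule spmf_map_outside) (use False set in blast)
    moreover have "Dprob R S T p x = 0" using False tr_PW[OF S, of T] by (auto simp: Dprob_def Bprob_def)
    ultimately show ?thesis unfolding map by simp
  qed
qed

end

section \<open>Conclusion\<close>

lemma integrable_of_nn_integral:
  fixes f :: "'a \<Rightarrow> real"
  assumes "\<And>x. 0 \<le> f x" "(\<integral>\<^sup>+ x. ennreal (f x) \<partial>measure_spmf A) \<le> ennreal Q"
  shows "integrable (measure_spmf A) f"
proof (rule integrableI_nonneg)
  show "(\<integral>\<^sup>+ x. ennreal (f x) \<partial>measure_spmf A) < \<infinity>"
    using assms(2) by (rule order_le_less_trans) simp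
qed (use assms in auto)

theorem theorem2p2:
  fixes c :: nat and dcost :: "nat \<Rightarrow> nat"
  assumes draw_cost: "\<forall>X. dcost X \<le> c * (X + 1)"
  shows "\<exists>C::real. \<forall>(n::nat) (R::nat \<Rightarrow> nat \<Rightarrow> bool) (k::nat) (l::nat) (p::real).
     (\<forall>a\<in>{1..n}. R a a) \<and> (\<forall>a\<in>{1..n}. \<forall>b\<in>{1..n}. R a b \<longrightarrow> R b a) \<and>
     k < l \<and> l \<le> n \<and> 0 < p \<and> ereal p < pS R {1..k}
     \<longrightarrow>
       (let A = A2 c dcost R n p k l; Sk = {1..k}; Sl = {1..k} - Lnb R n l in
        lossless_spmf A \<and>
        (\<forall>x. spmf (map_spmf (\<lambda>ws. tr R (fst ws)) A) x = Dprob R Sk (Lnb R n l) p x) \<and>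
        integrable (measure_spmf A) (\<lambda>ws. (real (length (fst ws)))\<^sup>2) \<and>
        integrable (measure_spmf A) (\<lambda>ws. (real (snd ws))\<^sup>2) \<and>
        (\<integral>ws. real (snd ws) \<partial>measure_spmf A) \<le> C * real (max k 1) / mu R Sk p \<and>
        (\<integral>ws. real (length (fst ws)) \<partial>measure_spmf A)
          = p * (deriv (mu R Sl) p / mu R Sl p - deriv (mu R Sk) p / mu R Sk p))"
proof (intro exI[of _ "14 * real c"] allI impI, elim conjE)
  fix n R k l and p :: real
  assume R: "\<forall>a\<in>{1..n}. R a a" "\<forall>a\<in>{1..n}. \<forall>b\<in>{1..n}. R a b \<longrightarrow> R b a"
    and kl: "k < l" "l \<le> n" and p: "0 < p" "ereal p < pS R {1..k}"
  interpret dependence R n using R by unfold_locales auto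
  define A where "A = A2 c dcost R n p k l"
  let ?S = "{1..k}" and ?T = "Lnb R n l"
  have k: "k \<le> n" and S: "?S \<subseteq> {1..n}" using kl by auto
  \<comment> \<open>The margin above \<open>p\<close> is needed for the moments of the
    length.\<close>
  obtain p' where p': "p < p'" "mu_pos ?S p'" using mu_pos_of_less_pS[OF S p(2)] by blast
  have pos: "mu_pos ?S p" using mu_pos_mono[OF p'(2)] p'(1) by simp
  define C where "C = mu R ?S p / mu R (?S - ?T) p"
  have mpos: "0 < mu R ?S p" "0 < mu R (?S - ?T) p"
    using mu_posD[OF pos] mu_posD[OF mu_pos_subset[OF S pos], of "?S - ?T"] p by auto
  then have C: "0 \<le> C" by (simp add: C_def)
  have ll: "lossless_spmf A" unfolding A_def by (rule A2_law(1)[OF k pos p(1)])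
  have law: "spmf (map_spmf fst A) w = (if w \<in> PW ?S ?T then C * p ^ length w else 0)" for w
    unfolding A_def C_def by (rule A2_law(2)[OF k pos p(1)])
  have tr: "spmf (map_spmf (\<lambda>ws. tr R (fst ws)) A) x = Dprob R ?S ?T p x" for x
    by (rule trace_law[OF S pos _ law[unfolded C_def]]) (use p in simp)
  note nnl = nn_integral_length_law[OF S _ C law]
  note ls = npw_length_sums[OF S p'(2) p(1) p'(1), of ?T]
  have "(\<integral>\<^sup>+ ws. ennreal ((real (length (fst ws)))\<^sup>2) \<partial>measure_spmf A)
      = ennreal (C * (\<Sum>m. (real m)\<^sup>2 * real (npw ?S ?T m) * p ^ m))"
    by (rule nnl[where f = "\<lambda>m. (real m)\<^sup>2"]) (use p ls(2) in \<open>auto intro: summable_sums\<close>)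
  then have L2: "integrable (measure_spmf A) (\<lambda>ws. (real (length (fst ws)))\<^sup>2)"
    by (intro integrable_of_nn_integral) auto
  let ?E = "p * (deriv (mu R (?S - ?T)) p / mu R (?S - ?T) p - deriv (mu R ?S) p / mu R ?S p)"
  have "(\<integral>\<^sup>+ ws. ennreal (real (length (fst ws))) \<partial>measure_spmf A)
      = ennreal (C * (mu R (?S - ?T) p / mu R ?S p * ?E))"
    by (rule nnl[where f = real]) (use p ls(1) in auto)
  also have "C * (mu R (?S - ?T) p / mu R ?S p * ?E) = ?E" using mpos by (simp add: C_def)
  finally have nn: "(\<integral>\<^sup>+ ws. ennreal (real (length (fst ws))) \<partial>measure_spmf A) = ennreal ?E" .
  \<comment> \<open>\<open>ennreal\<close> truncates negative reals, so the mean can be read off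
    only once \<open>?E\<close> is known to be nonnegative; it is proportional to a sum of
    nonnegative terms.\<close>
  have "0 \<le> mu R (?S - ?T) p / mu R ?S p * ?E"
    by (rule sums_le[OF _ sums_zero ls(1)]) (use p in auto)
  then have E: "0 \<le> ?E" using mpos by (simp add: zero_le_mult_iff zero_le_divide_iff)
  have L1: "(\<integral>ws. real (length (fst ws)) \<partial>measure_spmf A) = ?E"
    using nn E by (subst integral_eq_nn_integral) auto
  obtain Q where Q: "0 \<le> Q" "(\<integral>\<^sup>+ ws. ennreal ((real (snd ws))\<^sup>2) \<partial>measure_spmf A) \<le> ennreal Q"
    using A2_cost(2)[OF k pos p(1) draw_cost] unfolding A_def by blast
  then have S2: "integrable (measure_spmf A) (\<lambda>ws. (real (snd ws))\<^sup>2)"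
    by (intro integrable_of_nn_integral) auto
  let ?B = "(2 * real c + 12 * real c * real k) / mu R ?S p"
  have "(\<integral>\<^sup>+ ws. ennreal (real (snd ws)) \<partial>measure_spmf A) \<le> ennreal ?B"
    unfolding A_def by (rule A2_cost(1)[OF k pos p(1) draw_cost])
  moreover have "0 \<le> ?B" using mpos by simp
  ultimately have "(\<integral>ws. real (snd ws) \<partial>measure_spmf A) \<le> ?B"
    by (subst integral_eq_nn_integral) (auto intro: enn2real_leI)
  \<comment> \<open>\<open>14 = 2 + 12\<close>; the maximum with 1 absorbs the constant term when
    \<open>k = 0\<close>.\<close>
  also have "\<dots> \<le> 14 * real c * real (max k 1) / mu R ?S p"
  proof (intro divide_right_mono)
    have "2 * real c * 1 \<le> 2 * real c * real (max k 1)" "12 * real c * real k \<le> 12 * real c * real (max k 1)"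
      by (intro mult_left_mono; simp)+
    then show "2 * real c + 12 * real c * real k \<le> 14 * real c * real (max k 1)" by simp
  qed (use mpos in simp)
  finally have S1: "(\<integral>ws. real (snd ws) \<partial>measure_spmf A) \<le> 14 * real c * real (max k 1) / mu R ?S p" .
  show "let A = A2 c dcost R n p k l; Sk = {1..k}; Sl = {1..k} - Lnb R n l in
        lossless_spmf A \<and>
        (\<forall>x. spmf (map_spmf (\<lambda>ws. tr R (fst ws)) A) x = Dprob R Sk (Lnb R n l) p x) \<and>
        integrable (measure_spmf A) (\<lambda>ws. (real (length (fst ws)))\<^sup>2) \<and>
        integrable (measure_spmf A) (\<lambda>ws. (real (snd ws))\<^sup>2) \<and>
        (\<integral>ws. real (snd ws) \<partial>measure_spmf A) \<le> 14 * real c * real (max k 1) / mu R Sk p \<and>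
        (\<integral>ws. real (length (fst ws)) \<partial>measure_spmf A)
          = p * (deriv (mu R Sl) p / mu R Sl p - deriv (mu R Sk) p / mu R Sk p)"
    unfolding Let_def A_def[symmetric] using ll tr L2 S2 S1 L1 by blast
qed

end
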